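(* Let $m\ge1$ be an integer. For integers $n\ge0$ and $k\ge1$ let $\mathrm{H}^m(1-n,k)$ be the coefficient of $(s-(1-n))^{-k}$ in the Laurent expansion of $\mathcal{H}^m(s)$ about $s=1-n$. Then for all $n\ge0$, $k\ge1$, $$\mathrm{H}^m(1-n,k)=\sum_{\ell=0}^m\binom m\ell\gamma^{m-\ell}a_n(\ell,k),$$ where the $a_n(\ell,k)$ are rational numbers given by $a_n(\ell,k)=\ell(\ell-1)\cdots(\ell-k+2)\,a_n(\ell-k+1)$ (the product is empty, equal to $1$, when $k=1$; when $\ell<k-1$ the product contains the factor $0$ and $a_n(\ell,k)=0$). Moreover, for every integer $k\ge0$, as formal power series in $x$, $$\sum_{n=0}^\infty\mathrm{H}^m(1-n,k+1)x^n=m(m-1)\cdots(m-k+1)\,(\gamma+f(x))^{m-k}$$ (for $k>m$ the prefactor contains $0$ and the right side is $0$).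
   Context: $H_n=1+\frac12+\cdots+\frac1n$; $\mathcal{H}^m(s)=\sum_{n\ge1}H_n^m n^{-s}$ for $\Re(s)>1$, meromorphically continued to $\mathbb{C}$. $\gamma$ is the Euler–Mascheroni constant and $\zeta$ the Riemann zeta function. $f(x)=\sum_{n\ge1}(-1)^n\zeta(1-n)x^n=\frac x2+\zeta(-1)x^2+\zeta(-3)x^4+\cdots$. The numbers $a_n(\ell)$ ($n,\ell\ge0$) are defined by $a_n(0)=1$ if $n=0$, $a_n(0)=0$ otherwise, and $a_n(\ell+1)=\sum_{j=1}^{n-\ell}(-1)^j\zeta(1-j)a_{n-j}(\ell)$ (empty sum $=0$); equivalently $f(x)^\ell=\sum_{n}a_n(\ell)x^n$. *)

theory Defs
  imports "HOL-Complex_Analysis.Complex_Analysis"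
begin

text \<open>
  The meromorphic continuation to the whole plane of a function given on \<open>Re s > 1\<close>. Requiring
  the continuation to be nicely meromorphic (continuous away from its poles, with value 0 at
  them) makes it unique as a function on all of \<open>\<complex>\<close>; see \<open>meromorphic_continuation_unique\<close>.
\<close>

definition is_meromorphic_continuation :: "(complex \<Rightarrow> complex) \<Rightarrow> (complex \<Rightarrow> complex) \<Rightarrow> bool" where
  "is_meromorphic_continuation g F \<longleftrightarrow>
     F nicely_meromorphic_on UNIV \<and> (\<forall>s. Re s > 1 \<longrightarrow> F s = g s)"

definition meromorphic_continuation :: "(complex \<Rightarrow> complex) \<Rightarrow> complex \<Rightarrow> complex" where
  "meromorphic_continuation g = (THE F. is_meromorphic_continuation g F)"

lemma meromorphic_continuation_unique:
  assumes "is_meromorphic_continuation g F" "is_meromorphic_continuation g G"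
  shows   "F = G"
proof -
  have F: "F nicely_meromorphic_on UNIV" and G: "G nicely_meromorphic_on UNIV"
    and eq: "\<And>s. Re s > 1 \<Longrightarrow> F s = G s"
    using assms by (auto simp: is_meromorphic_continuation_def)
  have mero: "(\<lambda>s. F s - G s) meromorphic_on UNIV"
    using F G by (auto simp: nicely_meromorphic_on_def intro!: meromorphic_intros)
  have "(\<forall>\<^sub>\<approx>s\<in>UNIV. F s - G s = 0) \<or> (\<forall>\<^sub>\<approx>s\<in>UNIV. F s - G s \<noteq> 0)"
    by (intro meromorphic_imp_constant_or_avoid mero) auto
  moreover have "\<not> (\<forall>\<^sub>\<approx>s\<in>UNIV. F s - G s \<noteq> 0)"
  proof
    assume "\<forall>\<^sub>\<approx>s\<in>UNIV. F s - G s \<noteq> 0"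
    hence "eventually (\<lambda>s. F s - G s \<noteq> 0) (at 2)"
      by (rule eventually_cosparse_imp_eventually_at) auto
    moreover have "eventually (\<lambda>s. s \<in> {s. Re s > 1}) (at (2 :: complex))"
      by (intro eventually_at_in_open') (auto simp: open_halfspace_Re_gt)
    ultimately have "eventually (\<lambda>_. False) (at (2 :: complex))"
      by eventually_elim (use eq in auto)
    thus False by simp
  qed
  ultimately have cosparse: "\<forall>\<^sub>\<approx>s\<in>UNIV. F s - G s = 0" by blast
  have "F z = G z" for z
  proof -
    have ev: "eventually (\<lambda>s. F s = G s) (at z)"
      using eventually_cosparse_imp_eventually_at[OF cosparse, of z UNIV] by simp
    have pole: "is_pole F z \<longleftrightarrow> is_pole G z"
      by (rule is_pole_cong) (use ev in auto)
    have lim: "F \<midarrow>z\<rightarrow> c \<longleftrightarrow> G \<midarrow>z\<rightarrow> c" for c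
      by (rule tendsto_cong[OF ev])
    have "(is_pole F z \<and> F z = 0) \<or> F \<midarrow>z\<rightarrow> F z" "(is_pole G z \<and> G z = 0) \<or> G \<midarrow>z\<rightarrow> G z"
      using F G by (auto simp: nicely_meromorphic_on_def)
    moreover have "\<not> (is_pole F z \<and> F \<midarrow>z\<rightarrow> c)" "\<not> (is_pole G z \<and> G \<midarrow>z\<rightarrow> c)" for c
      using not_tendsto_and_filterlim_at_infinity[of "at z"] by (auto simp: is_pole_def)
    moreover have "c = d" if "F \<midarrow>z\<rightarrow> c" "F \<midarrow>z\<rightarrow> d" for c d
      using that by (rule LIM_unique)
    ultimately show ?thesis
      using pole lim by metis
  qed
  thus ?thesis by blast
qed

lemma meromorphic_continuation_eqI:
  assumes "is_meromorphic_continuation g F"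
  shows   "meromorphic_continuation g = F"
  unfolding meromorphic_continuation_def
  using assms meromorphic_continuation_unique by (intro the_equality) auto

definition riemann_zeta :: "complex \<Rightarrow> complex" where
  "riemann_zeta = meromorphic_continuation (\<lambda>s. \<Sum>n. 1 / of_nat (Suc n) powr s)"

definition harmonic_zeta :: "nat \<Rightarrow> complex \<Rightarrow> complex" where
  "harmonic_zeta m = meromorphic_continuation (\<lambda>s. \<Sum>n. harm (Suc n) ^ m / of_nat (Suc n) powr s)"

text \<open>
  The coefficient of \<open>(s - s\<^sub>0) ^ (-k)\<close> in the Laurent expansion of \<open>harmonic_zeta m\<close> about
  \<open>s\<^sub>0\<close>. (The library's \<open>laurent_expansion f s\<^sub>0\<close> is a series in the local variable \<open>s - s\<^sub>0\<close>.)
\<close>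

definition harmonic_zeta_coeff :: "nat \<Rightarrow> complex \<Rightarrow> nat \<Rightarrow> complex" where
  "harmonic_zeta_coeff m s\<^sub>0 k = fls_nth (laurent_expansion (harmonic_zeta m) s\<^sub>0) (- int k)"

definition f_series :: "complex fps" where
  "f_series = Abs_fps (\<lambda>n. if n = 0 then 0 else (-1) ^ n * riemann_zeta (1 - of_nat n))"

text \<open>The truncated subtraction \<open>n - l\<close> yields the empty sum for \<open>n \<le> l\<close>, as intended.\<close>

fun a_coeff :: "nat \<Rightarrow> nat \<Rightarrow> complex" where
  "a_coeff n 0 = (if n = 0 then 1 else 0)"
| "a_coeff n (Suc l) = (\<Sum>j=1..n-l. (-1) ^ j * riemann_zeta (1 - of_nat j) * a_coeff (n - j) l)"

text \<open>
  Meant for \<open>k \<ge> 1\<close>. If \<open>l < k - 1\<close>, the product contains the factor 0, so that the truncation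
  of the index \<open>l + 1 - k\<close> is immaterial.
\<close>

definition a_coeff_k :: "nat \<Rightarrow> nat \<Rightarrow> nat \<Rightarrow> complex" where
  "a_coeff_k n l k = (\<Prod>i<k-1. of_nat l - of_nat i) * a_coeff n (l + 1 - k)"

end

theory Submission
  imports Defs "HOL-Real_Asymp.Real_Asymp"
begin

text \<open>
  Write \<open>c\<^sub>j = (-1)\<^sup>j \<zeta>(1 - j)\<close> for the coefficients of \<open>f\<close>. They are the coefficients of the
  asymptotic expansion of \<open>H\<^sub>n - ln n - \<gamma>\<close> in powers of \<open>1/n\<close>, because both families satisfy
  the same recurrence. For the zeta values it comes from expanding the summands of the telescoping series
  \<open>\<Sum>\<^sub>n (n\<^bsup>1-s\<^esup> - (n-1)\<^bsup>1-s\<^esup>) = 0\<close> binomially, which also continues \<open>\<zeta>\<close> to the whole plane; for the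
  harmonic numbers it says that the increments of the expansion cancel to all orders.

  Hence \<open>H\<^sub>n\<^sup>m\<close> is, up to \<open>O(n\<^bsup>-N\<^esup>)\<close>, a linear combination of the terms \<open>(ln n)\<^sup>k n\<^bsup>-j\<^esup>\<close> with coefficients
  \<open>(m choose k) [x\<^sup>j] (\<gamma> + f(x))\<^bsup>m-k\<^esup>\<close>. The Dirichlet series of such a term is \<open>(-1)\<^sup>k \<zeta>\<^bsup>(k)\<^esup>(s + j)\<close>,
  whose only singularity is at \<open>s = 1 - j\<close>, with principal part \<open>k! (s + j - 1)\<^bsup>-k-1\<^esup>\<close>. This gives the
  continuation of \<open>\<H>\<^sup>m\<close> to every half-plane together with all its principal parts.
\<close>

section \<open>Dirichlet series with coefficients of polynomial growth\<close>

text \<open>The index \<open>n\<close> stands for the positive integer \<open>Suc n\<close>, so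
  \<open>e n\<close> is the coefficient of \<open>(n+1)^(-s)\<close> in \<open>dseries e\<close>,
  and the comparison function never has base 0.\<close>

definition growth :: "(nat \<Rightarrow> complex) \<Rightarrow> real \<Rightarrow> bool" where
  "growth e a \<longleftrightarrow> (\<lambda>n. norm (e n)) \<in> O(\<lambda>n. real (Suc n) powr a)"

definition dseries :: "(nat \<Rightarrow> complex) \<Rightarrow> complex \<Rightarrow> complex" where
  "dseries e s = (\<Sum>n. e n / of_nat (Suc n) powr s)"

lemma growth_mono: "growth e a \<Longrightarrow> a \<le> b \<Longrightarrow> growth e b"
  unfolding growth_def
  by (erule landau_o.big_trans, intro landau_o.bigI[of 1]) (auto intro!: always_eventually powr_mono)

lemma growthI:
  assumes "eventually (\<lambda>n. norm (e n) \<le> C * real (Suc n) powr a) sequentially"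
  shows "growth e a"
  unfolding growth_def by (rule bigoI[of _ C]) (use assms in simp)

lemma growthE:
  assumes "growth e a"
  obtains C where "C > 0" "eventually (\<lambda>n. norm (e n) \<le> C * real (Suc n) powr a) sequentially"
  using assms unfolding growth_def by (auto elim!: landau_o.bigE)

lemma growth_const: "growth (\<lambda>_. c) 0"
  by (rule growthI[of _ "norm c"]) auto

lemma growth_add:
  assumes "growth e a" "growth f a"
  shows "growth (\<lambda>n. e n + f n) a"
proof -
  have "(\<lambda>n. norm (e n) + norm (f n)) \<in> O(\<lambda>n. real (Suc n) powr a)"
    using assms unfolding growth_def by (rule sum_in_bigo)
  thus ?thesis unfolding growth_def
    by (rule landau_o.big_trans[rotated])
       (intro landau_o.bigI[of 1], auto intro!: always_eventually norm_triangle_ineq)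
qed

lemma growth_mult:
  assumes "growth e a" "growth f b"
  shows "growth (\<lambda>n. e n * f n) (a + b)"
  using landau_o.big_mult[OF assms[unfolded growth_def]]
  by (simp add: growth_def norm_mult powr_add)

lemma growth_uminus: "growth e a \<Longrightarrow> growth (\<lambda>n. - e n) a"
  by (simp add: growth_def)

lemma growth_diff: "growth e a \<Longrightarrow> growth f a \<Longrightarrow> growth (\<lambda>n. e n - f n) a"
  using growth_add[OF _ growth_uminus] by fastforce

lemma growth_sum:
  "(\<And>i. i \<in> I \<Longrightarrow> growth (e i) a) \<Longrightarrow> growth (\<lambda>n. \<Sum>i\<in>I. e i n) a"
  by (induction I rule: infinite_finite_induct)
     (auto intro: growth_add growthI[of _ 0])

lemma growth_power:
  assumes "growth e a" shows "growth (\<lambda>n. e n ^ k) (a * real k)"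
proof (induction k)
  case 0
  show ?case using growth_const[of 1] by simp
next
  case (Suc k)
  show ?case using growth_mult[OF assms Suc] by (simp add: algebra_simps)
qed

lemma growth_ln:
  assumes "\<epsilon> > 0"
  shows "growth (\<lambda>n. ln (of_nat (Suc n))) \<epsilon>"
proof -
  have "(\<lambda>n. ln (real (Suc n))) \<in> O(\<lambda>n. real (Suc n) powr \<epsilon>)"
    using assms by real_asymp
  moreover have "norm (ln (of_nat (Suc n)) :: complex) = ln (real (Suc n))" for n
    using Ln_of_real[of "real (Suc n)"] by (simp del: of_nat_Suc)
  ultimately show ?thesis
    unfolding growth_def by simp
qed

lemma growth_ln_power:
  assumes "\<epsilon> > 0"
  shows "growth (\<lambda>n. ln (of_nat (Suc n)) ^ k) \<epsilon>"
proof -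
  have "growth (\<lambda>n. ln (of_nat (Suc n)) ^ k) (\<epsilon> / real (Suc k) * real k)"
    by (intro growth_power growth_ln) (use assms in simp)
  thus ?thesis
    by (rule growth_mono) (use assms in \<open>simp add: field_simps\<close>)
qed

lemma growth_harm:
  assumes "\<epsilon> > 0"
  shows "growth (\<lambda>n. harm (Suc n)) \<epsilon>"
proof -
  have "Bseq (\<lambda>n. harm (Suc n) - ln (of_nat (Suc n)) :: real)"
    using LIMSEQ_Suc[OF euler_mascheroni_LIMSEQ] convergent_imp_Bseq convergent_def by blast
  then obtain K where K: "\<And>n. norm (harm (Suc n) - ln (of_nat (Suc n)) :: real) \<le> K"
    by (auto simp: Bseq_def)
  have "growth (\<lambda>n. of_real (harm (Suc n) - ln (of_nat (Suc n)))) 0"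
    by (rule growthI[of _ K]) (use K in \<open>simp_all only: norm_of_real real_norm_def, simp\<close>)
  hence "growth (\<lambda>n. of_real (harm (Suc n) - ln (of_nat (Suc n)))) \<epsilon>"
    by (rule growth_mono) (use assms in auto)
  from growth_add[OF this growth_ln[OF assms]] show ?thesis
    using Ln_of_real[of "real (Suc n)" for n] by (simp add: of_real_harm del: of_nat_Suc)
qed

lemma summable_Suc_powr: "a < -1 \<Longrightarrow> summable (\<lambda>n. real (Suc n) powr a)"
  using summable_real_powr_iff[of a] by (subst (asm) summable_Suc_iff[symmetric]) simp

text \<open>Termwise differentiation by local comparison. On the ball around \<open>x\<close> whose
  radius \<open>d\<close> is half the distance to the line \<open>Re s = a + 1\<close>, the terms
  are eventually dominated by a multiple of \<open>(n+1)^(-1-d)\<close>.\<close>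

lemma dseries_deriv:
  assumes "growth e a" "Re s > a + 1"
  shows "summable (\<lambda>n. e n / of_nat (Suc n) powr s)"
    and "(dseries e has_field_derivative dseries (\<lambda>n. - ln (of_nat (Suc n)) * e n) s) (at s)"
proof -
  define S where "S = {s. Re s > a + 1}"
  define f where "f = (\<lambda>n s. e n / of_nat (Suc n) powr s)"
  define f' where "f' = (\<lambda>n s. - ln (of_nat (Suc n)) * e n / of_nat (Suc n) powr s)"
  obtain C where C: "C > 0" "eventually (\<lambda>n. norm (e n) \<le> C * real (Suc n) powr a) sequentially"
    using assms(1) by (rule growthE)
  have "\<exists>g g'. \<forall>x\<in>S. (\<lambda>n. f n x) sums g x \<and> (\<lambda>n. f' n x) sums g' x \<and>
          (g has_field_derivative g' x) (at x)"
  proof (rule series_and_derivative_comparison_local)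
    show "open S" by (simp add: S_def open_halfspace_Re_gt)
    show "(f n has_field_derivative f' n x) (at x)" if "x \<in> S" for n x
      unfolding f_def f'_def
      by (auto intro!: derivative_eq_intros simp: powr_def exp_minus field_simps simp del: of_nat_Suc)
  next
    fix x assume x: "x \<in> S"
    define d where "d = (Re x - (a + 1)) / 2"
    have d: "d > 0" using x by (simp add: d_def S_def)
    have "summable (\<lambda>n. C * real (Suc n) powr (a - Re x + d))"
      by (intro summable_mult summable_Suc_powr) (use x in \<open>simp add: d_def S_def field_simps\<close>)
    moreover have "eventually (\<lambda>n. \<forall>y\<in>ball x d \<inter> S. norm (f n y) \<le> C * real (Suc n) powr (a - Re x + d)) sequentially"
      using C(2)
    proof eventually_elim
      case (elim n)
      show ?case
      proof
        fix y assume y: "y \<in> ball x d \<inter> S"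
        have "\<bar>Re (x - y)\<bar> \<le> norm (x - y)" by (rule abs_Re_le_cmod)
        with y have ry: "Re y \<ge> Re x - d" by (auto simp: dist_norm)
        have "norm (f n y) = norm (e n) * real (Suc n) powr (- Re y)"
          unfolding f_def
          by (simp add: norm_divide norm_powr_real_powr powr_minus divide_simps del: of_nat_Suc)
        also have "\<dots> \<le> (C * real (Suc n) powr a) * real (Suc n) powr (- Re x + d)"
          using C(1) ry elim by (intro mult_mono powr_mono) auto
        also have "\<dots> = C * real (Suc n) powr (a - Re x + d)"
          by (simp add: powr_add [symmetric] algebra_simps del: of_nat_Suc)
        finally show "norm (f n y) \<le> C * real (Suc n) powr (a - Re x + d)" .
      qed
    qed
    ultimately show "\<exists>d h. 0 < d \<and> summable h \<and>
        (\<forall>\<^sub>F n in sequentially. \<forall>y\<in>ball x d \<inter> S. norm (f n y) \<le> h n)"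
      using d by blast
  qed
  then obtain g g' where g: "\<And>x. x \<in> S \<Longrightarrow> (\<lambda>n. f n x) sums g x"
     "\<And>x. x \<in> S \<Longrightarrow> (\<lambda>n. f' n x) sums g' x"
     "\<And>x. x \<in> S \<Longrightarrow> (g has_field_derivative g' x) (at x)" by blast
  have s: "s \<in> S" using assms by (simp add: S_def)
  show "summable (\<lambda>n. e n / of_nat (Suc n) powr s)"
    using g(1)[OF s] by (auto simp: f_def sums_iff)
  have "(dseries e has_field_derivative g' s) (at s)"
  proof (rule has_field_derivative_transform_within_open[OF g(3)[OF s]])
    show "open S" by (simp add: S_def open_halfspace_Re_gt)
    show "g x = dseries e x" if "x \<in> S" for x
      using g(1)[OF that] by (auto simp: f_def dseries_def sums_iff)
  qed (fact s)
  moreover have "g' s = dseries (\<lambda>n. - ln (of_nat (Suc n)) * e n) s"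
    using g(2)[OF s] by (auto simp: f'_def dseries_def sums_iff)
  ultimately show "(dseries e has_field_derivative dseries (\<lambda>n. - ln (of_nat (Suc n)) * e n) s) (at s)"
    by simp
qed

lemma dseries_holomorphic:
  "growth e a \<Longrightarrow> dseries e holomorphic_on {s. Re s > a + 1}"
  by (rule holomorphic_onI)
     (metis (mono_tags, lifting) dseries_deriv(2) field_differentiable_at_within field_differentiable_def mem_Collect_eq)

text \<open>Powers of logarithms and of harmonic numbers have every positive growth exponent, while
  exponent 0 may fail. At a given \<open>s\<close> half of the margin \<open>Re s - 1\<close> can
  serve as the exponent.\<close>

lemma dseries_holomorphic_eps:
  assumes "\<And>\<epsilon>. \<epsilon> > 0 \<Longrightarrow> growth e \<epsilon>"
  shows "dseries e holomorphic_on {s. Re s > 1}"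
proof (rule holomorphic_onI)
  fix s :: complex assume "s \<in> {s. Re s > 1}"
  hence "Re s > (Re s - 1) / 2 + 1" "(Re s - 1) / 2 > 0" by (auto simp: field_simps)
  thus "dseries e field_differentiable at s within {s. Re s > 1}"
    using dseries_deriv(2)[OF assms] field_differentiable_at_within field_differentiable_def by blast
qed

lemma dseries_summable_eps:
  assumes "\<And>\<epsilon>. \<epsilon> > 0 \<Longrightarrow> growth e \<epsilon>" "Re s > 1"
  shows "summable (\<lambda>n. e n / of_nat (Suc n) powr s)"
  using dseries_deriv(1)[OF assms(1)[of "(Re s - 1) / 2"]] assms(2) by (auto simp: field_simps)

text \<open>Each derivative of \<open>(n+1)^(-s)\<close> brings down a factor
  \<open>- ln (n+1)\<close>; the sign \<open>(-1)^k\<close> compensates for the minus signs.\<close>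

lemma dseries_ln_power:
  assumes "Re s > 1"
  shows "dseries (\<lambda>n. ln (of_nat (Suc n)) ^ k) s = (-1) ^ k * (deriv ^^ k) (dseries (\<lambda>_. 1)) s"
  using assms
proof (induction k arbitrary: s)
  case (Suc k)
  let ?l = "\<lambda>n. ln (of_nat (Suc n)) :: complex"
  have ev: "eventually (\<lambda>w. (deriv ^^ k) (dseries (\<lambda>_. 1)) w = (-1) ^ k * dseries (\<lambda>n. ?l n ^ k) w) (nhds s)"
    using eventually_nhds_in_open[OF open_halfspace_Re_gt[of 1], of s, simplified, OF Suc.prems]
    by eventually_elim
       (use Suc.IH in \<open>simp flip: power_mult_distrib mult.assoc del: of_nat_Suc Ln_of_nat\<close>)
  have eps: "Re s > (Re s - 1) / 2 + 1" "(Re s - 1) / 2 > 0" using Suc.prems by (auto simp: field_simps)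
  have d: "deriv (dseries (\<lambda>n. ?l n ^ k)) s = dseries (\<lambda>n. - ?l n * ?l n ^ k) s"
    by (intro DERIV_imp_deriv dseries_deriv(2)[OF growth_ln_power[OF eps(2)] eps(1)])
  have fd: "dseries (\<lambda>n. ?l n ^ k) field_differentiable at s"
    using dseries_deriv(2)[OF growth_ln_power[OF eps(2)] eps(1)] field_differentiable_def by blast
  have "(deriv ^^ Suc k) (dseries (\<lambda>_. 1)) s = deriv (\<lambda>w. (-1) ^ k * dseries (\<lambda>n. ?l n ^ k) w) s"
    by (simp only: funpow.simps o_apply) (intro deriv_cong_ev ev refl)
  also have "\<dots> = (-1) ^ k * dseries (\<lambda>n. - ?l n * ?l n ^ k) s"
    using deriv_cmult[OF fd] d by simp
  also have "dseries (\<lambda>n. - ?l n * ?l n ^ k) s = - dseries (\<lambda>n. ?l n ^ Suc k) s"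
    unfolding dseries_def
    using suminf_minus[OF dseries_summable_eps[OF growth_ln_power Suc.prems, of "Suc k"]]
    by (simp add: mult_ac del: of_nat_Suc)
  finally show ?case by simp
qed simp

section \<open>Continuation of the zeta function\<close>

text \<open>The point is uniformity in the exponent \<open>z\<close>. Since
  \<open>norm (z gchoose k)\<close> is at most \<open>pochhammer R k / fact k\<close>, which is
  \<open>(-R) gchoose k\<close> up to sign, the tail is dominated by that of the convergent binomial
  series of \<open>(1 - 1/2) powr (-R)\<close>.\<close>

lemma binomial_series_remainder:
  fixes R :: real
  assumes "R \<ge> 0"
  obtains C where "C \<ge> 0"
    "\<And>z x :: complex. norm z \<le> R \<Longrightarrow> norm x \<le> 1 / 2 \<Longrightarrow>
       norm ((1 + x) powr z - (\<Sum>k<K. (z gchoose k) * x ^ k)) \<le> C * norm x ^ K"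
proof -
  define B where "B = (\<lambda>k. pochhammer R k / fact k)"
  have B: "norm (z gchoose k) \<le> B k" if "norm z \<le> R" for z :: complex and k
  proof -
    have "norm (pochhammer (- z) k) \<le> pochhammer R k"
      unfolding pochhammer_prod prod_norm [symmetric]
      by (intro prod_mono conjI norm_ge_zero order.trans[OF norm_triangle_ineq]) (use that in auto)
    thus ?thesis
      by (simp add: gbinomial_pochhammer norm_divide norm_mult norm_power B_def divide_right_mono)
  qed
  have B_nonneg: "B k \<ge> 0" for k
    using assms by (auto simp: B_def pochhammer_prod intro!: prod_nonneg divide_nonneg_nonneg)
  have "summable (\<lambda>k. ((-R) gchoose k) * (-1/2) ^ k)"
    using gen_binomial_real[of "-1/2" "-R"] by (auto simp: sums_iff)
  also have "(\<lambda>k. ((-R) gchoose k) * (-1/2) ^ k) = (\<lambda>k. B k * (1/2) ^ k)"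
    by (auto simp: gbinomial_pochhammer B_def power_divide power_minus')
  finally have sB: "summable (\<lambda>k. B k * (1/2) ^ k)" .
  define C where "C = 2 ^ K * (\<Sum>k. B (k + K) * (1/2) ^ (k + K))"
  have sBK: "summable (\<lambda>k. B (k + K) * (1/2) ^ (k + K))"
    by (rule summable_ignore_initial_segment[OF sB])
  show thesis
  proof (rule that)
    show "C \<ge> 0"
      unfolding C_def using B_nonneg sBK by (intro mult_nonneg_nonneg suminf_nonneg) auto
    fix z x :: complex
    assume z: "norm z \<le> R" and x: "norm x \<le> 1 / 2"
    let ?f = "\<lambda>k. (z gchoose k) * x ^ k"
    have sums: "?f sums ((1 + x) powr z)"
      using x by (intro gen_binomial_complex) auto
    hence eq: "(1 + x) powr z - (\<Sum>k<K. ?f k) = (\<Sum>k. ?f (k + K))"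
      using suminf_minus_initial_segment[of ?f K] by (simp add: sums_iff)
    have le: "norm (?f (k + K)) \<le> norm x ^ K * 2 ^ K * (B (k + K) * (1/2) ^ (k + K))" for k
    proof -
      have "norm (?f (k + K)) \<le> B (k + K) * (norm x ^ K * (1/2) ^ k)"
        unfolding norm_mult norm_power power_add
        by (subst mult.commute[of "norm x ^ k"]) (intro mult_mono B z mult_left_mono power_mono x; use B_nonneg in auto)
      also have "\<dots> = norm x ^ K * 2 ^ K * (B (k + K) * (1/2) ^ (k + K))"
        by (simp add: power_add field_simps)
      finally show ?thesis .
    qed
    have "norm (\<Sum>k. ?f (k + K)) \<le> (\<Sum>k. norm x ^ K * 2 ^ K * (B (k + K) * (1/2) ^ (k + K)))"
      by (rule norm_suminf_le[OF le]) (intro summable_mult sBK)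
    also have "\<dots> = C * norm x ^ K"
      by (subst suminf_mult[OF sBK]) (simp add: C_def)
    finally show "norm ((1 + x) powr z - (\<Sum>k<K. ?f k)) \<le> C * norm x ^ K"
      by (simp only: eq)
  qed
qed

text \<open>
  For \<open>n = 0\<close> the base \<open>1 - 1 / of_nat (Suc n)\<close> vanishes and \<open>0 powr z = 0\<close>, also for \<open>z = 0\<close>. This is what
  makes the sum over all \<open>n\<close> telescope to \<open>0\<close>, and it is the source of the residue of \<open>\<zeta>\<close> at \<open>1\<close>.
\<close>

definition zrem_term :: "nat \<Rightarrow> nat \<Rightarrow> complex \<Rightarrow> complex" where
  "zrem_term K n s = of_nat (Suc n) powr (1 - s) *
     ((1 - 1 / of_nat (Suc n)) powr (1 - s) - (\<Sum>k<K. ((1 - s) gchoose k) * (- 1 / of_nat (Suc n)) ^ k))"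

definition zrem :: "nat \<Rightarrow> complex \<Rightarrow> complex" where
  "zrem K s = (\<Sum>n. zrem_term K n s)"

text \<open>Removing the binomial terms with \<open>k \<le> J\<close> leaves summands of order
  \<open>n^(1 - Re s - (J+1))\<close>, locally uniformly in \<open>s\<close>. They are summable
  exactly while \<open>Re s > 1 - J\<close>.\<close>

lemma zrem_holomorphic: "zrem (Suc J) holomorphic_on {s. Re s > 1 - real J}"
proof -
  define S where "S = {s. Re s > 1 - real J}"
  have "\<exists>g g'. \<forall>x\<in>S. (\<lambda>n. zrem_term (Suc J) n x) sums g x \<and> (\<lambda>n. deriv (zrem_term (Suc J) n) x) sums g' x \<and>
          (g has_field_derivative g' x) (at x)"
  proof (rule series_and_derivative_comparison_local)
    show "open S" by (simp add: S_def open_halfspace_Re_gt)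
    show "(zrem_term (Suc J) n has_field_derivative deriv (zrem_term (Suc J) n) x) (at x)" if "x \<in> S" for n x
    proof (rule DERIV_deriv_iff_field_differentiable[THEN iffD2])
      have "zrem_term (Suc J) n holomorphic_on UNIV"
      proof (cases n)
        \<comment> \<open>The base is 0, so the power vanishes for every exponent and a polynomial
          in \<open>s\<close> remains.\<close>
        case 0
        have "(\<lambda>s. - (\<Sum>k<Suc J. ((1 - s) gchoose k) * (- 1) ^ k) :: complex) holomorphic_on UNIV"
          unfolding gbinomial_prod_rev by (intro holomorphic_intros) auto
        thus ?thesis unfolding 0 zrem_term_def [abs_def]
          by simp
      next
        case (Suc m)
        have "(1 - 1 / of_nat (Suc (Suc m)) :: complex) \<noteq> 0"
          by (simp add: field_simps del: of_nat_Suc)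
        thus ?thesis unfolding zrem_term_def [abs_def] Suc gbinomial_prod_rev powr_def
          by (auto intro!: holomorphic_intros simp del: of_nat_Suc)
      qed
      thus "zrem_term (Suc J) n field_differentiable at x"
        by (simp add: holomorphic_on_def)
    qed
  next
    fix x assume x: "x \<in> S"
    define d where "d = (Re x - (1 - real J)) / 2"
    have d: "d > 0" using x by (simp add: d_def S_def)
    define R where "R = norm (1 - x) + d"
    obtain C where C: "C \<ge> 0" "\<And>z x :: complex. norm z \<le> R \<Longrightarrow> norm x \<le> 1 / 2 \<Longrightarrow>
       norm ((1 + x) powr z - (\<Sum>k<Suc J. (z gchoose k) * x ^ k)) \<le> C * norm x ^ Suc J"
      using binomial_series_remainder[of R] d by (metis R_def add_nonneg_nonneg less_eq_real_def norm_ge_zero)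
    have "summable (\<lambda>n. C * real (Suc n) powr (d - Re x - real J))"
      by (intro summable_mult summable_Suc_powr) (use x in \<open>simp add: d_def S_def field_simps\<close>)
    moreover have "eventually (\<lambda>n. \<forall>y\<in>ball x d \<inter> S. norm (zrem_term (Suc J) n y) \<le> C * real (Suc n) powr (d - Re x - real J)) sequentially"
      \<comment> \<open>From \<open>n = 1\<close> on, \<open>1 / (n+1)\<close> is at most 1/2, as
        the remainder bound demands.\<close>
      using eventually_ge_at_top[of 1]
    proof eventually_elim
      case (elim n)
      show ?case
      proof
        fix y assume y: "y \<in> ball x d \<inter> S"
        have "\<bar>Re (x - y)\<bar> \<le> norm (x - y)" by (rule abs_Re_le_cmod)
        with y have ry: "Re y \<ge> Re x - d" by (auto simp: dist_norm)
        have "norm (1 - y) \<le> norm (1 - x) + norm (x - y)" by norm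
        hence yR: "norm (1 - y) \<le> R" using y by (simp add: R_def dist_norm)
        have "norm (zrem_term (Suc J) n y) =
                real (Suc n) powr (1 - Re y) * norm ((1 + (- 1 / of_nat (Suc n))) powr (1 - y) -
                 (\<Sum>k<Suc J. ((1 - y) gchoose k) * (- 1 / of_nat (Suc n)) ^ k))"
          unfolding zrem_term_def norm_mult
          by (subst norm_powr_real_powr) auto
        also have "\<dots> \<le> real (Suc n) powr (1 - Re y) * (C * norm (- 1 / of_nat (Suc n) :: complex) ^ Suc J)"
          by (intro mult_left_mono C yR) (use elim in \<open>auto simp: norm_divide field_simps simp del: of_nat_Suc\<close>)
        also have "norm (- 1 / of_nat (Suc n) :: complex) ^ Suc J = real (Suc n) powr (- real (Suc J))"
          by (simp add: norm_divide power_one_over powr_minus powr_realpow divide_simps del: of_nat_Suc power_Suc)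
        also have "real (Suc n) powr (1 - Re y) * (C * \<dots>) = C * real (Suc n) powr (1 - Re y - real (Suc J))"
          by (simp only: powr_add [symmetric] mult.left_commute[of _ C] diff_conv_add_uminus)
        also have "\<dots> \<le> C * real (Suc n) powr (d - Re x - real J)"
          using C(1) ry by (intro mult_left_mono powr_mono) auto
        finally show "norm (zrem_term (Suc J) n y) \<le> C * real (Suc n) powr (d - Re x - real J)" .
      qed
    qed
    ultimately show "\<exists>d h. 0 < d \<and> summable h \<and>
        (\<forall>\<^sub>F n in sequentially. \<forall>y\<in>ball x d \<inter> S. norm (zrem_term (Suc J) n y) \<le> h n)"
      using d by blast
  qed
  then obtain g g' where g: "\<And>x. x \<in> S \<Longrightarrow> (\<lambda>n. zrem_term (Suc J) n x) sums g x"
     "\<And>x. x \<in> S \<Longrightarrow> (g has_field_derivative g' x) (at x)" by blast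
  have "g holomorphic_on S"
    by (rule holomorphic_onI) (use g(2) in \<open>meson field_differentiable_at_within field_differentiable_def\<close>)
  also have "?this \<longleftrightarrow> zrem (Suc J) holomorphic_on S"
    by (rule holomorphic_cong) (use g(1) in \<open>auto simp: zrem_def sums_iff\<close>)
  finally show "zrem (Suc J) holomorphic_on {s. Re s > 1 - real J}"
    by (simp add: S_def)
qed

text \<open>Factoring \<open>n^(1-s)\<close> as \<open>(n+1)^(1-s) (1 - 1/(n+1))^(1-s)\<close> turns
  each remainder term into a telescoping difference minus finitely many terms of zeta series at
  \<open>s + k\<close>. The factor \<open>s + k - 1\<close>, split off from the next binomial
  coefficient, is the one that cancels the pole of zeta there.\<close>

lemma dseries_zeta_recurrence:
  assumes "Re s > 1"
  shows "zrem (Suc J) s = - (\<Sum>k<J. (-1) ^ k / of_nat (Suc k) * ((1 - s) gchoose k) *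
                              ((s + of_nat k - 1) * dseries (\<lambda>_. 1) (s + of_nat k)))"
proof -
  let ?q = "\<lambda>n. of_nat (Suc n) :: complex"
  define g where "g = (\<lambda>n. of_nat n powr (1 - s) :: complex)"
  have "(\<lambda>n. norm (g (Suc n))) = (\<lambda>n. real (Suc n) powr (1 - Re s))"
    unfolding g_def by (intro ext, subst norm_powr_real_powr) auto
  also have "\<dots> \<longlonglongrightarrow> 0"
    using assms by real_asymp
  finally have "g \<longlonglongrightarrow> 0"
    using LIMSEQ_imp_Suc tendsto_norm_zero_iff by blast
  from telescope_sums'[OF this] have tel: "(\<lambda>n. g n - g (Suc n)) sums 0"
    by (simp add: g_def)
  have sm: "summable (\<lambda>n. 1 / ?q n powr w)" if "Re w > 1" for w
    using that by (intro dseries_summable_eps growth_mono[OF growth_const]) auto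
  define T where "T = (\<lambda>k n. ((1 - s) gchoose Suc k) * (-1) ^ Suc k * (1 / ?q n powr (s + of_nat k)))"
  have T: "T k sums (((1 - s) gchoose Suc k) * (-1) ^ Suc k * dseries (\<lambda>_. 1) (s + of_nat k))" for k
    unfolding T_def dseries_def using assms
    by (intro sums_mult summable_sums sm) auto
  have eq: "zrem_term (Suc J) n s = (g n - g (Suc n)) - (\<Sum>k<J. T k n)" for n
  proof -
    have 1: "?q n powr (1 - s) * (1 - 1 / ?q n) powr (1 - s) = g n"
    proof -
      have "?q n powr (1 - s) * (1 - 1 / ?q n) powr (1 - s) =
              (of_real (real (Suc n)) * of_real (1 - 1 / real (Suc n))) powr (1 - s)"
        by (subst powr_times_real) auto
      also have "of_real (real (Suc n)) * of_real (1 - 1 / real (Suc n)) = (of_nat n :: complex)"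
        unfolding of_real_mult [symmetric] by (simp add: right_diff_distrib)
      finally show ?thesis by (simp add: g_def)
    qed
    have 2: "?q n powr (1 - s) * (((1 - s) gchoose Suc k) * (- 1 / ?q n) ^ Suc k) = T k n" for k
      unfolding T_def power_divide[of "- 1" "?q n"]
      by (simp add: powr_diff powr_add powr_nat' field_simps del: of_nat_Suc)
    show ?thesis
      unfolding zrem_term_def sum.lessThan_Suc_shift
      by (simp only: right_diff_distrib distrib_left sum_distrib_left 1 2) (simp add: g_def del: of_nat_Suc)
  qed
  have "(\<lambda>n. (g n - g (Suc n)) - (\<Sum>k<J. T k n)) sums
          (0 - (\<Sum>k<J. ((1 - s) gchoose Suc k) * (-1) ^ Suc k * dseries (\<lambda>_. 1) (s + of_nat k)))"
    by (intro sums_diff tel sums_sum T)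
  hence "zrem (Suc J) s = - (\<Sum>k<J. ((1 - s) gchoose Suc k) * (-1) ^ Suc k * dseries (\<lambda>_. 1) (s + of_nat k))"
    unfolding zrem_def eq by (simp add: sums_iff)
  also have "(\<Sum>k<J. ((1 - s) gchoose Suc k) * (-1) ^ Suc k * dseries (\<lambda>_. 1) (s + of_nat k)) =
    (\<Sum>k<J. (-1) ^ k / of_nat (Suc k) * ((1 - s) gchoose k) *
                              ((s + of_nat k - 1) * dseries (\<lambda>_. 1) (s + of_nat k)))"
  proof (intro sum.cong refl)
    fix k
    have "((1 - s) gchoose Suc k) = - (s + of_nat k - 1) / of_nat (Suc k) * ((1 - s) gchoose k)"
      using gbinomial_mult_1[of "1 - s" k] by (simp add: field_simps del: of_nat_Suc)
    thus "((1 - s) gchoose Suc k) * (-1) ^ Suc k * dseries (\<lambda>_. 1) (s + of_nat k) =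
       (-1) ^ k / of_nat (Suc k) * ((1 - s) gchoose k) * ((s + of_nat k - 1) * dseries (\<lambda>_. 1) (s + of_nat k))"
      by (simp only: power_Suc divide_inverse mult_minus_left mult_minus_right minus_minus mult_1_left mult_ac)
  qed
  finally show ?thesis .
qed

lemma halfplane_identity:
  assumes "f holomorphic_on {s. Re s > a}" "g holomorphic_on {s. Re s > a}"
    and "\<And>s. Re s > b \<Longrightarrow> f s = g s" and "Re s > a"
  shows "f s = g s"
proof (rule analytic_continuation_open[where s = "{s. Re s > max a b}" and s' = "{s. Re s > a}" and f = f and g = g])
  show "{s. max a b < Re s} \<noteq> {}"
    using gt_ex[of "max a b"] by (metis (mono_tags) Re_complex_of_real empty_iff mem_Collect_eq)
  show "connected {s. a < Re s}"
    by (intro convex_connected convex_halfspace_Re_gt)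
qed (use assms in \<open>auto simp: open_halfspace_Re_gt simp del: max_less_iff_conj\<close>)

text \<open>
  The summand \<open>k = 0\<close> of the recurrence is \<open>(s - 1) \<zeta>(s)\<close>; the others only involve \<open>\<zeta>(s + k)\<close> with
  \<open>k \<ge> 1\<close>. So each use of the recurrence gains a strip of width \<open>1\<close>.
\<close>

lemma zeta_halfplane:
  "\<exists>Z. Z holomorphic_on {s. Re s > 1 - real N} \<and>
       (\<forall>s. Re s > 1 \<longrightarrow> Z s = (s - 1) * dseries (\<lambda>_. 1) s)"
proof (induction N)
  case 0
  have "dseries (\<lambda>_. 1) holomorphic_on {s. Re s > 1 - real 0}"
    using dseries_holomorphic[OF growth_const[of 1]] by simp
  thus ?case
    by (intro exI[of _ "\<lambda>s. (s - 1) * dseries (\<lambda>_. 1) s"]) (auto intro!: holomorphic_intros)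
next
  case (Suc N)
  then obtain Z where Z: "Z holomorphic_on {s. Re s > 1 - real N}"
      "\<And>s. Re s > 1 \<Longrightarrow> Z s = (s - 1) * dseries (\<lambda>_. 1) s" by blast
  \<comment> \<open>The recurrence with \<open>J = N + 1\<close>, solved for its summand
    \<open>k = 0\<close>.\<close>
  define Z' where "Z' = (\<lambda>s. - zrem (Suc (Suc N)) s -
     (\<Sum>k<N. (-1) ^ Suc k / of_nat (Suc (Suc k)) * ((1 - s) gchoose Suc k) * Z (s + of_nat (Suc k))))"
  have "Z' holomorphic_on {s. Re s > 1 - real (Suc N)}"
    unfolding Z'_def gbinomial_prod_rev
    by (intro holomorphic_intros zrem_holomorphic holomorphic_on_compose_gen[OF _ Z(1), unfolded o_def]) auto
  moreover have "Z' s = (s - 1) * dseries (\<lambda>_. 1) s" if "Re s > 1" for s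
  proof -
    have "zrem (Suc (Suc N)) s = - ((s - 1) * dseries (\<lambda>_. 1) s +
       (\<Sum>k<N. (-1) ^ Suc k / of_nat (Suc (Suc k)) * ((1 - s) gchoose Suc k) * 
         ((s + of_nat (Suc k) - 1) * dseries (\<lambda>_. 1) (s + of_nat (Suc k)))))"
      unfolding dseries_zeta_recurrence[OF that] sum.lessThan_Suc_shift by simp
    also have "\<dots> = - ((s - 1) * dseries (\<lambda>_. 1) s +
       (\<Sum>k<N. (-1) ^ Suc k / of_nat (Suc (Suc k)) * ((1 - s) gchoose Suc k) * Z (s + of_nat (Suc k))))"
      by (intro arg_cong2[of _ _ _ _ "\<lambda>x y. - (x + y)"] sum.cong refl, subst Z(2)) (use that in auto)
    finally show ?thesis unfolding Z'_def by simp
  qed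
  ultimately show ?case by blast
qed

text \<open>Two continuations agree on the smaller of their half-planes by
  \<open>halfplane_identity\<close>, so evaluating at each \<open>s\<close> any one that is defined
  there gives a single entire function.\<close>

lemma zeta_entire:
  obtains Z where "Z holomorphic_on UNIV" "\<And>s. Re s > 1 \<Longrightarrow> Z s = (s - 1) * dseries (\<lambda>_. 1) s"
proof -
  from zeta_halfplane have "\<exists>ZN. \<forall>N. ZN N holomorphic_on {s. Re s > 1 - real N} \<and>
       (\<forall>s. Re s > 1 \<longrightarrow> ZN N s = (s - 1) * dseries (\<lambda>_. 1) s)" by (intro choice allI)
  then obtain ZN where ZN: "\<And>N. ZN N holomorphic_on {s. Re s > 1 - real N}"
     "\<And>N s. Re s > 1 \<Longrightarrow> ZN N s = (s - 1) * dseries (\<lambda>_. 1) s" by blast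
  define N where "N = (\<lambda>s. Suc (nat \<lceil>1 - Re s\<rceil>))"
  define Z where "Z = (\<lambda>s. ZN (N s) s)"
  have N: "Re s > 1 - real (N s)" for s
    unfolding N_def by linarith
  have eq: "Z s = ZN M s" if "Re s > 1 - real M" for s M
  proof -
    have "ZN (N s) s = ZN M s"
    proof (rule halfplane_identity[where f = "ZN (N s)" and g = "ZN M"])
      show "ZN (N s) holomorphic_on {z. Re z > 1 - real (min (N s) M)}"
           "ZN M holomorphic_on {z. Re z > 1 - real (min (N s) M)}"
        by (rule holomorphic_on_subset[OF ZN(1)]; force)+
      show "Re s > 1 - real (min (N s) M)"
        using that N[of s] by (auto simp: min_def)
      show "ZN (N s) z = ZN M z" if "Re z > 1" for z
        using ZN(2)[OF that] by simp
    qed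
    thus ?thesis by (simp add: Z_def)
  qed
  have "Z field_differentiable at s" for s
  proof -
    have "ZN (N s) field_differentiable at s"
      using holomorphic_on_imp_differentiable_at[OF ZN(1) open_halfspace_Re_gt] N[of s] by simp
    then obtain D where "(ZN (N s) has_field_derivative D) (at s)"
      by (auto simp: field_differentiable_def)
    hence "(Z has_field_derivative D) (at s)"
      by (rule has_field_derivative_transform_within_open[OF _ open_halfspace_Re_gt])
         (use N[of s] eq in auto)
    thus ?thesis by (auto simp: field_differentiable_def)
  qed
  hence "Z holomorphic_on UNIV" by (simp add: holomorphic_on_def)
  moreover have "Z s = (s - 1) * dseries (\<lambda>_. 1) s" if "Re s > 1" for s
    using ZN(2)[OF that] by (simp add: Z_def)
  ultimately show thesis by (rule that)
qed

lemma zrem_identity: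
  assumes Z: "Z holomorphic_on UNIV" "\<And>s. Re s > 1 \<Longrightarrow> Z s = (s - 1) * dseries (\<lambda>_. 1) s"
    and s: "Re s > 1 - real J"
  shows "zrem (Suc J) s = - (\<Sum>k<J. (-1) ^ k / of_nat (Suc k) * ((1 - s) gchoose k) * Z (s + of_nat k))"
proof (rule halfplane_identity[where f = "zrem (Suc J)" and a = "1 - real J" and b = 1])
  show "(\<lambda>s. - (\<Sum>k<J. (-1) ^ k / of_nat (Suc k) * ((1 - s) gchoose k) * Z (s + of_nat k)))
           holomorphic_on {s. Re s > 1 - real J}"
    unfolding gbinomial_prod_rev
    by (intro holomorphic_intros holomorphic_on_compose_gen[OF _ Z(1), unfolded o_def]) auto
  fix s :: complex assume s: "Re s > 1"
  show "zrem (Suc J) s = - (\<Sum>k<J. (-1) ^ k / of_nat (Suc k) * ((1 - s) gchoose k) * Z (s + of_nat k))"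
    unfolding dseries_zeta_recurrence[OF s]
    by (intro arg_cong[of _ _ uminus] sum.cong refl, subst Z(2)) (use s in auto)
qed (use s zrem_holomorphic in auto)

text \<open>At \<open>s = 1\<close> the exponent \<open>1 - s\<close> is 0 and the binomial series
  reduces to its constant term 1. Every remainder term therefore vanishes except the one at
  \<open>n = 0\<close>, where \<open>0 powr 0 = 0\<close> leaves -1.\<close>

lemma zeta_residue:
  assumes Z: "Z holomorphic_on UNIV" "\<And>s. Re s > 1 \<Longrightarrow> Z s = (s - 1) * dseries (\<lambda>_. 1) s"
  shows "Z 1 = 1"
proof -
  have "zrem_term 2 n 1 = (if n = 0 then -1 else 0)" for n
    by (auto simp: zrem_term_def numeral_2_eq_2 field_simps)
  hence "zrem 2 1 = (\<Sum>n\<in>{0}. -1)"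
    unfolding zrem_def by (subst suminf_finite[of "{0}"]) auto
  moreover have "zrem (Suc 1) 1 = - Z 1"
    by (subst zrem_identity[OF Z]) auto
  ultimately show ?thesis by (simp add: numeral_2_eq_2)
qed

text \<open>At \<open>s = 1 - M\<close> the exponent \<open>1 - s = M\<close> is a natural number,
  so the binomial series terminates and all remainder terms are zero. With \<open>M \<ge> 1\<close>
  this includes \<open>n = 0\<close>, because then \<open>0 powr M\<close> agrees with
  \<open>0 ^ M\<close>.\<close>

lemma zeta_bernoulli_recurrence:
  assumes Z: "Z holomorphic_on UNIV" "\<And>s. Re s > 1 \<Longrightarrow> Z s = (s - 1) * dseries (\<lambda>_. 1) s"
    and M: "M \<ge> 1"
  shows "(\<Sum>k\<le>M. (-1) ^ k / of_nat (Suc k) * of_nat (M choose k) * Z (1 - of_nat M + of_nat k)) = 0"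
proof -
  have zero: "zrem_term (Suc (Suc M)) n (1 - of_nat M) = 0" for n
  proof -
    have "(1 - 1 / of_nat (Suc n) :: complex) powr of_nat M = (1 - 1 / of_nat (Suc n)) ^ M"
      using M by (intro powr_nat') auto
    also have "\<dots> = (- 1 / of_nat (Suc n) + 1) ^ M" by simp
    also have "\<dots> = (\<Sum>k\<le>M. of_nat (M choose k) * (- 1 / of_nat (Suc n)) ^ k)"
      by (subst binomial_ring) simp
    also have "\<dots> = (\<Sum>k<Suc (Suc M). (of_nat M gchoose k) * (- 1 / of_nat (Suc n)) ^ k)"
      by (simp add: lessThan_Suc_atMost binomial_gbinomial [symmetric] binomial_eq_0)
    finally show ?thesis by (simp add: zrem_term_def)
  qed
  have "zrem (Suc (Suc M)) (1 - of_nat M) = 0"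
    unfolding zrem_def zero by simp
  thus ?thesis
    by (subst (asm) zrem_identity[OF Z])
       (simp_all add: lessThan_Suc_atMost binomial_gbinomial)
qed

text \<open>\<open>remove_sings\<close> supplies the normalisation in the definition of the
  continuation: limits at removable points and the value 0 at poles.\<close>

lemma riemann_zeta_eq_remove_sings:
  assumes Z: "Z holomorphic_on UNIV" "\<And>s. Re s > 1 \<Longrightarrow> Z s = (s - 1) * dseries (\<lambda>_. 1) s"
  shows "riemann_zeta = remove_sings (\<lambda>s. Z s / (s - 1))"
proof -
  have "Z analytic_on UNIV" using Z(1) by (simp add: analytic_on_open)
  hence an: "Z analytic_on A" for A by (rule analytic_on_subset) auto
  have "(\<lambda>s. Z s / (s - 1)) meromorphic_on UNIV"
    by (intro meromorphic_intros analytic_on_imp_meromorphic_on an)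
  hence "remove_sings (\<lambda>s. Z s / (s - 1)) nicely_meromorphic_on UNIV"
    by (rule remove_sings_nicely_meromorphic)
  moreover have "remove_sings (\<lambda>s. Z s / (s - 1)) s = (\<Sum>n. 1 / of_nat (Suc n) powr s)" if "Re s > 1" for s
    by (subst remove_sings_at_analytic)
       (use that in \<open>auto intro!: analytic_intros an simp: Z(2) dseries_def simp del: of_nat_Suc\<close>)
  ultimately show ?thesis unfolding riemann_zeta_def
    by (intro meromorphic_continuation_eqI) (auto simp: is_meromorphic_continuation_def)
qed

lemma riemann_zeta_eq:
  assumes Z: "Z holomorphic_on UNIV" "\<And>s. Re s > 1 \<Longrightarrow> Z s = (s - 1) * dseries (\<lambda>_. 1) s"
    and "s \<noteq> 1"
  shows "riemann_zeta s = Z s / (s - 1)"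
proof -
  have "Z analytic_on UNIV" using Z(1) by (simp add: analytic_on_open)
  hence "Z analytic_on {s}" by (rule analytic_on_subset) auto
  hence "(\<lambda>s. Z s / (s - 1)) analytic_on {s}"
    using assms(3) by (intro analytic_intros) auto
  thus ?thesis
    using fun_cong[OF riemann_zeta_eq_remove_sings[OF Z], of s] by (simp only: remove_sings_at_analytic)
qed

section \<open>The coefficients of \<open>f_series\<close>: recurrence and rationality\<close>

text \<open>For \<open>j \<ge> 1\<close> this is \<open>- B_j / j\<close> with the Bernoulli numbers
  normalised by \<open>B_1 = -1/2\<close>.\<close>

definition hcoeff :: "nat \<Rightarrow> complex" where
  "hcoeff j = (-1) ^ j * riemann_zeta (1 - of_nat j)"

text \<open>This is \<open>zeta_bernoulli_recurrence\<close> reindexed by \<open>j = M - k\<close>: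
  the summand \<open>k = M\<close> contains the residue \<open>Z 1 = 1\<close> and becomes the right
  side, and \<open>j (M choose j) = (M - j + 1) (M choose (j - 1))\<close> simplifies the others. In
  this form it matches the increments of the harmonic expansion.\<close>

lemma hcoeff_recurrence:
  assumes M: "M \<ge> 1"
  shows "(\<Sum>j=1..M. of_nat (M choose (j - 1)) * hcoeff j) = 1 / of_nat (Suc M)"
proof -
  obtain Z where Z: "Z holomorphic_on UNIV" "\<And>s. Re s > 1 \<Longrightarrow> Z s = (s - 1) * dseries (\<lambda>_. 1) s"
    using zeta_entire by blast
  have Zj: "Z (1 - of_nat j) = (-1) ^ Suc j * of_nat j * hcoeff j" if "j \<ge> 1" for j
    using riemann_zeta_eq[OF Z, of "1 - of_nat j"] that
    by (simp add: hcoeff_def field_simps flip: power_mult_distrib)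
  let ?g = "\<lambda>k. (-1) ^ k / of_nat (Suc k) * of_nat (M choose k) * Z (1 - of_nat M + of_nat k)"
  have "0 = (\<Sum>k\<le>M. ?g k)"
    using zeta_bernoulli_recurrence[OF Z M] by simp
  also have "\<dots> = (\<Sum>k<M. ?g k) + (-1) ^ M / of_nat (Suc M)"
    by (simp add: lessThan_Suc_atMost [symmetric] zeta_residue[OF Z])
  also have "(\<Sum>k<M. ?g k) = (\<Sum>j=1..M. ?g (M - j))"
    by (rule sum.reindex_bij_witness[of _ "\<lambda>j. M - j" "\<lambda>k. M - k"]) auto
  also have "\<dots> = (\<Sum>j=1..M. - ((-1) ^ M) * (of_nat (M choose (j - 1)) * hcoeff j))"
  proof (intro sum.cong refl)
    fix j assume j: "j \<in> {1..M}"
    have "j * (M choose j) = (M - (j - 1)) * (M choose (j - 1))"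
      using binomial_absorb_comp[of M "j - 1"] j binomial_absorption[of "j - 1" M] by simp
    hence ch: "of_nat j * of_nat (M choose j) = (of_nat (Suc (M - j)) * of_nat (M choose (j - 1)) :: complex)"
      using j by (simp flip: of_nat_mult add: Suc_diff_le del: of_nat_Suc)
    have "?g (M - j) = (-1) ^ (M - j) / of_nat (Suc (M - j)) * of_nat (M choose j) * Z (1 - of_nat j)"
      using j by (simp add: of_nat_diff binomial_symmetric[of j M] del: of_nat_Suc)
    also have "\<dots> = (-1) ^ (M - j) * (-1) ^ Suc j * hcoeff j * (of_nat j * of_nat (M choose j) / of_nat (Suc (M - j)))"
      using j by (simp add: Zj del: of_nat_Suc)
    also have "of_nat j * of_nat (M choose j) / of_nat (Suc (M - j)) = (of_nat (M choose (j - 1)) :: complex)"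
      unfolding ch by (simp del: of_nat_Suc)
    also have "(-1) ^ (M - j) * (-1) ^ Suc j = (- ((-1) ^ M) :: complex)"
      using j by (simp flip: power_add)
    finally show "?g (M - j) = - ((-1) ^ M) * (of_nat (M choose (j - 1)) * hcoeff j)" by simp
  qed
  also have "\<dots> = - ((-1) ^ M) * (\<Sum>j=1..M. of_nat (M choose (j - 1)) * hcoeff j)"
    by (rule sum_distrib_left [symmetric])
  finally have "(-1) ^ M * ((\<Sum>j=1..M. of_nat (M choose (j - 1)) * hcoeff j) - 1 / of_nat (Suc M)) = 0"
    by (simp add: algebra_simps)
  thus ?thesis by simp
qed

text \<open>In the recurrence \<open>hcoeff M\<close> has the nonzero coefficient \<open>M\<close>,
  so it is determined rationally by its predecessors.\<close>

lemma hcoeff_rational: "j \<ge> 1 \<Longrightarrow> hcoeff j \<in> \<rat>"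
proof (induction j rule: less_induct)
  case (less M)
  have "{1..M} = insert M {1..<M}" using less.prems by auto
  hence "of_nat M * hcoeff M + (\<Sum>j\<in>{1..<M}. of_nat (M choose (j - 1)) * hcoeff j) = 1 / of_nat (Suc M)"
    using hcoeff_recurrence[OF less.prems] less.prems binomial_symmetric[of 1 M] by simp
  hence "hcoeff M = (1 / of_nat (Suc M) - (\<Sum>j\<in>{1..<M}. of_nat (M choose (j - 1)) * hcoeff j)) / of_nat M"
    using less.prems by (simp add: field_simps del: of_nat_Suc)
  also have "\<dots> \<in> \<rat>"
    using less.IH by (intro Rats_divide Rats_diff Rats_1 Rats_of_nat Rats_sum Rats_mult) auto
  finally show ?case .
qed

section \<open>Dirichlet series of powers of the logarithm\<close>

lemma higher_deriv_inverse:
  assumes "s \<noteq> a"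
  shows "(deriv ^^ k) (\<lambda>s. 1 / (s - a)) s = (-1) ^ k * fact k / (s - a) ^ Suc k"
  using assms
proof (induction k arbitrary: s)
  case (Suc k)
  have ev: "eventually (\<lambda>w. (deriv ^^ k) (\<lambda>s. 1 / (s - a)) w = (-1) ^ k * fact k / (w - a) ^ Suc k) (nhds s)"
  proof (rule eventually_mono[OF eventually_nhds_in_open[of "- {a}" s]])
    show "(deriv ^^ k) (\<lambda>s. 1 / (s - a)) w = (-1) ^ k * fact k / (w - a) ^ Suc k" if "w \<in> - {a}" for w
      by (rule Suc.IH) (use that in auto)
  qed (use Suc.prems in auto)
  have "(deriv ^^ Suc k) (\<lambda>s. 1 / (s - a)) s = deriv (\<lambda>w. (-1) ^ k * fact k / (w - a) ^ Suc k) s"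
    by (simp only: funpow.simps o_apply) (intro deriv_cong_ev ev refl)
  also have "\<dots> = - ((-1) ^ k * fact k * (of_nat (Suc k) * (s - a) ^ k)) / ((s - a) ^ Suc k * (s - a) ^ Suc k)"
    using Suc.prems by (intro DERIV_imp_deriv) (auto intro!: derivative_eq_intros simp del: power_Suc of_nat_Suc)
  also have "\<dots> = (-1) ^ Suc k * fact (Suc k) / (s - a) ^ Suc (Suc k)"
    using Suc.prems by (simp add: divide_simps) 
  finally show ?case .
qed auto

text \<open>Since \<open>Z 1 = 1\<close>, the difference quotient of \<open>Z\<close> at 1 is an
  entire function equal to zeta minus \<open>1 / (s - 1)\<close>. Differentiating \<open>k\<close>
  times gives the principal part and the entire rest.\<close>

lemma dseries_ln_power_entire:
  obtains E where "\<And>k. E k holomorphic_on UNIV"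
    "\<And>k s. Re s > 1 \<Longrightarrow> dseries (\<lambda>n. ln (of_nat (Suc n)) ^ k) s = fact k / (s - 1) ^ Suc k + E k s"
proof -
  obtain Z where Z: "Z holomorphic_on UNIV" "\<And>s. Re s > 1 \<Longrightarrow> Z s = (s - 1) * dseries (\<lambda>_. 1) s"
    using zeta_entire by blast
  define E where "E = (\<lambda>z. if z = 1 then deriv Z 1 else (Z z - Z 1) / (z - 1))"
  have E: "E holomorphic_on UNIV"
    unfolding E_def by (rule pole_lemma_open[OF Z(1)]) auto
  have *: "dseries (\<lambda>_. 1) s = 1 / (s - 1) + E s" if "Re s > 1" for s
    using that Z(2)[OF that] by (auto simp: E_def zeta_residue[OF Z] field_simps)
  show thesis
  proof (rule that[of "\<lambda>k s. (-1) ^ k * (deriv ^^ k) E s"])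
    show "(\<lambda>s. (-1) ^ k * (deriv ^^ k) E s) holomorphic_on UNIV" for k
      by (intro holomorphic_intros E) auto
    fix k and s :: complex assume s: "Re s > 1"
    have "dseries (\<lambda>n. ln (of_nat (Suc n)) ^ k) s = (-1) ^ k * (deriv ^^ k) (dseries (\<lambda>_. 1)) s"
      by (rule dseries_ln_power[OF s])
    also have "(deriv ^^ k) (dseries (\<lambda>_. 1)) s = (deriv ^^ k) (\<lambda>s. 1 / (s - 1) + E s) s"
      by (rule higher_deriv_transform_within_open[where S = "{s. Re s > 1}"])
         (use s * in \<open>auto intro!: holomorphic_intros holomorphic_on_subset[OF E] dseries_holomorphic_eps growth_mono[OF growth_const] simp: open_halfspace_Re_gt\<close>)
    also have "\<dots> = (deriv ^^ k) (\<lambda>s. 1 / (s - 1)) s + (deriv ^^ k) E s"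
      by (rule higher_deriv_add[where S = "{s. Re s > 1}"])
         (use s in \<open>auto intro!: holomorphic_intros holomorphic_on_subset[OF E] simp: open_halfspace_Re_gt\<close>)
    also have "(deriv ^^ k) (\<lambda>s. 1 / (s - 1)) s = (-1) ^ k * fact k / (s - 1) ^ Suc k"
      by (rule higher_deriv_inverse) (use s in auto)
    also have "(-1) ^ k * ((-1) ^ k * fact k / (s - 1) ^ Suc k + (deriv ^^ k) E s) =
                 fact k / (s - 1) ^ Suc k + (-1) ^ k * (deriv ^^ k) E s"
      by (simp add: distrib_left flip: power_mult_distrib mult.assoc)
    finally show "dseries (\<lambda>n. ln (of_nat (Suc n)) ^ k) s = fact k / (s - 1) ^ Suc k + (-1) ^ k * (deriv ^^ k) E s" .
  qed
qed

section \<open>Gluing continuations on half-planes\<close>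

text \<open>The difference either vanishes or is nonzero outside a sparse set, and its zeros far to
  the right exclude the latter. Equality holds only near \<open>z\<close> because values at
  exceptional points are not controlled.\<close>

lemma meromorphic_halfplane_identity:
  assumes "F meromorphic_on {s. Re s > a}" "G meromorphic_on {s. Re s > a}"
    and eq: "\<And>s. Re s > b \<Longrightarrow> F s = G s" and z: "Re z > a"
  shows "eventually (\<lambda>s. F s = G s) (at z)"
proof -
  let ?A = "{s. Re s > a}"
  have "(\<lambda>s. F s - G s) meromorphic_on ?A"
    using assms by (intro meromorphic_intros) 
  hence "(\<forall>\<^sub>\<approx>s\<in>?A. F s - G s = 0) \<or> (\<forall>\<^sub>\<approx>s\<in>?A. F s - G s \<noteq> 0)"
    by (rule meromorphic_imp_constant_or_avoid)
       (auto simp: open_halfspace_Re_gt intro: convex_connected convex_halfspace_Re_gt)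
  moreover have "\<not> (\<forall>\<^sub>\<approx>s\<in>?A. F s - G s \<noteq> 0)"
  proof
    \<comment> \<open>A point in both half-planes.\<close>
    define c where "c = complex_of_real (max a b + 1)"
    assume "\<forall>\<^sub>\<approx>s\<in>?A. F s - G s \<noteq> 0"
    hence "eventually (\<lambda>s. F s - G s \<noteq> 0) (at c)"
      by (rule eventually_cosparse_imp_eventually_at) (auto simp: c_def)
    moreover have "eventually (\<lambda>s. s \<in> {s. Re s > b}) (at c)"
      by (intro eventually_at_in_open') (auto simp: open_halfspace_Re_gt c_def)
    ultimately have "eventually (\<lambda>_. False) (at c)"
      by eventually_elim (use eq in auto)
    thus False by simp
  qed
  ultimately have "\<forall>\<^sub>\<approx>s\<in>?A. F s - G s = 0" by blast
  from eventually_cosparse_imp_eventually_at[OF this, of z UNIV] z show ?thesis by simp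
qed

text \<open>The pieces agree only off sparse sets; after \<open>remove_sings\<close> they agree
  pointwise on overlaps and can be glued. On \<open>Re s > 1\<close> holomorphy of \<open>g\<close>
  guarantees that this changes no value.\<close>

lemma meromorphic_continuation_halfplanes:
  assumes FN: "\<And>N::nat. \<exists>F. F meromorphic_on {s. Re s > - real N} \<and> (\<forall>s. Re s > 1 \<longrightarrow> F s = g s)"
    and g: "g holomorphic_on {s. Re s > 1}"
  shows "is_meromorphic_continuation g (meromorphic_continuation g)"
proof -
  from FN obtain F :: "nat \<Rightarrow> complex \<Rightarrow> complex"
    where F: "\<And>N. F N meromorphic_on {s. Re s > - real N}" "\<And>N s. Re s > 1 \<Longrightarrow> F N s = g s"
    by metis
  define N where "N = (\<lambda>s. Suc (nat \<lceil>- Re s\<rceil>))"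
  have N: "Re s > - real (N s)" for s
    unfolding N_def by linarith
  define M where "M = (\<lambda>s. remove_sings (F (N s)) s)"
  have eq: "M s = remove_sings (F K) s" if "Re s > - real K" for s K
    unfolding M_def
  proof (intro remove_sings_cong refl meromorphic_halfplane_identity)
    show "F (N s) meromorphic_on {z. Re z > - real (min (N s) K)}"
         "F K meromorphic_on {z. Re z > - real (min (N s) K)}"
      by (rule meromorphic_on_subset[OF F(1)]; force)+
    show "Re s > - real (min (N s) K)" using that N[of s] by (auto simp: min_def)
    show "F (N s) z = F K z" if "Re z > 1" for z
      using F(2)[OF that] by simp
  qed
  have "is_meromorphic_continuation g M"
    unfolding is_meromorphic_continuation_def
  proof (intro conjI allI impI)
    fix s assume s: "Re s > 1"
    have "eventually (\<lambda>w. w \<in> {w. Re w > 1}) (at s)"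
      using s by (intro eventually_at_in_open') (auto simp: open_halfspace_Re_gt)
    hence "M s = remove_sings g s"
      unfolding M_def by (intro remove_sings_cong refl) (auto elim!: eventually_mono simp: F(2))
    also have "\<dots> = g s"
      by (rule remove_sings_at_analytic)
         (use g s analytic_on_open[OF open_halfspace_Re_gt, of g 1] in \<open>auto intro: analytic_on_subset\<close>)
    finally show "M s = g s" .
  next
    have nice: "M meromorphic_on {z} \<and> (is_pole M z \<and> M z = 0 \<or> M \<midarrow>z\<rightarrow> M z)" for z
    proof -
      define R where "R = remove_sings (F (N z))"
      have R: "R nicely_meromorphic_on {s. Re s > - real (N z)}"
        unfolding R_def by (intro remove_sings_nicely_meromorphic F)
      have "eventually (\<lambda>w. w \<in> {w. Re w > - real (N z)}) (at z)"
        using N[of z] by (intro eventually_at_in_open') (auto simp: open_halfspace_Re_gt)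
      hence ev: "eventually (\<lambda>w. M w = R w) (at z)"
        by eventually_elim (auto simp: eq R_def)
      have "R meromorphic_on {z}" "is_pole R z \<and> R z = 0 \<or> R \<midarrow>z\<rightarrow> R z"
        using R N[of z] by (auto simp: nicely_meromorphic_on_def intro: meromorphic_on_subset)
      moreover have "M z = R z" by (simp add: M_def R_def)
      ultimately show ?thesis
        using ev is_pole_cong[OF ev refl] tendsto_cong[OF ev] meromorphic_on_cong[of "{z}" M R "{z}"]
        by auto
    qed
    have "M meromorphic_on UNIV"
      using nice meromorphic_on_meromorphic_at[of M UNIV] by blast
    thus "M nicely_meromorphic_on UNIV"
      using nice by (auto simp: nicely_meromorphic_on_def)
  qed
  thus ?thesis using meromorphic_continuation_eqI by metis
qed

section \<open>Asymptotic expansion of the harmonic numbers\<close>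

text \<open>\<open>- d n\<close> is the sum of all later increments. Splitting their exponent as
  \<open>a\<close> and \<open>-2\<close> bounds the first factor by its value at
  \<open>Suc n\<close> and leaves a convergent series independent of \<open>n\<close>. This gives up
  one power against the best possible exponent \<open>a - 1\<close>.\<close>

lemma growth_telescope:
  assumes d: "d \<longlonglongrightarrow> 0" and g: "growth (\<lambda>n. d (Suc n) - d n) (a - 2)" and a: "a \<le> 0"
  shows "growth d a"
proof -
  obtain C where C: "C > 0"
    "eventually (\<lambda>n. norm (d (Suc n) - d n) \<le> C * real (Suc n) powr (a - 2)) sequentially"
    using g by (rule growthE)
  then obtain n0 where n0: "\<And>n. n \<ge> n0 \<Longrightarrow> norm (d (Suc n) - d n) \<le> C * real (Suc n) powr (a - 2)"
    by (auto simp: eventually_at_top_linorder)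
  define T where "T = (\<Sum>i. real (Suc i) powr (-2))"
  have "norm (d n) \<le> (C * T) * real (Suc n) powr a" if n: "n \<ge> n0" for n
  proof -
    have sT: "summable (\<lambda>i. real (Suc i) powr (-2))"
      by (rule summable_Suc_powr) auto
    have le: "norm (d (Suc i + n) - d (i + n)) \<le> C * real (Suc n) powr a * real (Suc i) powr (-2)" for i
    proof -
      have "norm (d (Suc i + n) - d (i + n)) \<le> C * real (Suc (i + n)) powr (a - 2)"
        using n0[of "i + n"] n by simp
      also have "\<dots> = C * (real (Suc (i + n)) powr a * real (Suc (i + n)) powr (-2))"
        by (simp add: powr_add [symmetric] del: of_nat_Suc)
      also have "\<dots> \<le> C * (real (Suc n) powr a * real (Suc i) powr (-2))"
        using C(1) a by (intro mult_left_mono mult_mono powr_mono2') auto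
      finally show ?thesis by simp
    qed
    have lim: "(\<lambda>i. d (i + n)) \<longlonglongrightarrow> 0"
      using d by (rule LIMSEQ_ignore_initial_segment)
    from telescope_sums[OF lim] have "(\<Sum>i. d (Suc i + n) - d (i + n)) = - d n"
      by (simp add: sums_iff)
    hence "norm (d n) = norm (\<Sum>i. d (Suc i + n) - d (i + n))" by simp
    also have "\<dots> \<le> (\<Sum>i. C * real (Suc n) powr a * real (Suc i) powr (-2))"
      by (rule norm_suminf_le[OF le]) (intro summable_mult sT)
    also have "\<dots> = (C * T) * real (Suc n) powr a"
      by (subst suminf_mult[OF sT]) (simp add: T_def)
    finally show ?thesis .
  qed
  thus ?thesis
    by (intro growthI[of _ "C * T"]) (auto simp: eventually_at_top_linorder)
qed

text \<open>The quotient by \<open>x^K\<close> has the shifted expansion, so it extends continuously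
  to 0 and is bounded nearby. The zero series is separate because its subdegree is 0 by
  convention.\<close>

lemma has_fps_expansion_bound:
  fixes f :: "complex \<Rightarrow> complex"
  assumes f: "f has_fps_expansion F" and F: "\<And>n. n < K \<Longrightarrow> fps_nth F n = 0"
  obtains C where "eventually (\<lambda>x. norm (f x) \<le> C * norm x ^ K) (at 0)"
proof (cases "F = 0")
  case True
  have "eventually (\<lambda>x. f x = 0) (nhds 0)"
    using f by (simp add: True has_fps_expansion_0_iff)
  hence "eventually (\<lambda>x. norm (f x) \<le> 0 * norm x ^ K) (at 0)"
    unfolding eventually_at_filter by eventually_elim auto
  thus thesis by (rule that)
next
  case False
  let ?g = "\<lambda>x. if x = 0 then fps_nth F K else f x / x ^ K"
  have "?g has_fps_expansion fps_shift K F"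
    by (intro has_fps_expansion_shift f subdegree_geI False F refl)
  hence "continuous (at 0) ?g"
    by (rule has_fps_expansion_imp_continuous)
  hence "?g \<midarrow>0\<rightarrow> fps_nth F K"
    by (simp add: continuous_within)
  hence "eventually (\<lambda>x. norm (?g x) < norm (fps_nth F K) + 1) (at 0)"
    by (intro order_tendstoD(2)[OF tendsto_norm]) auto
  moreover have "eventually (\<lambda>x. x \<noteq> 0) (at (0 :: complex))"
    by (auto simp: eventually_at_filter)
  ultimately have "eventually (\<lambda>x. norm (f x) \<le> (norm (fps_nth F K) + 1) * norm x ^ K) (at 0)"
    by eventually_elim (auto simp: norm_divide norm_power field_simps)
  thus thesis by (rule that)
qed

text \<open>
  The substitution \<open>x \<mapsto> x / (1 - x)\<close> turns \<open>1/n\<close> into \<open>1/(n-1)\<close>.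
\<close>

lemma fps_binomial_column:
  "inverse (1 - fps_X) * (fps_X * inverse (1 - fps_X)) ^ j = (Abs_fps (\<lambda>n. of_nat (n choose j)) :: 'a :: field_char_0 fps)"
proof (induction j)
  case 0
  show ?case by (simp add: fps_inverse_one_minus_fps_X)
next
  case (Suc j)
  \<comment> \<open>Multiplying by \<open>1 - fps_X\<close> takes differences in \<open>n\<close>,
    so this is Pascal's rule.\<close>
  have "(1 - fps_X) * Abs_fps (\<lambda>n. of_nat (n choose Suc j)) = fps_X * (Abs_fps (\<lambda>n. of_nat (n choose j)) :: 'a fps)"
  proof (rule fps_ext)
    fix n show "((1 - fps_X) * Abs_fps (\<lambda>n. of_nat (n choose Suc j))) $ n = (fps_X * (Abs_fps (\<lambda>n. of_nat (n choose j)) :: 'a fps)) $ n"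
      by (cases n) (simp_all add: left_diff_distrib)
  qed
  hence "Abs_fps (\<lambda>n. of_nat (n choose Suc j)) = inverse (1 - fps_X) * (fps_X * (Abs_fps (\<lambda>n. of_nat (n choose j)) :: 'a fps))"
  proof -
    assume eq: "(1 - fps_X) * Abs_fps (\<lambda>n. of_nat (n choose Suc j)) = fps_X * (Abs_fps (\<lambda>n. of_nat (n choose j)) :: 'a fps)"
    have "inverse (1 - fps_X) * ((1 - fps_X) * Abs_fps (\<lambda>n. of_nat (n choose Suc j))) =
            (Abs_fps (\<lambda>n. of_nat (n choose Suc j)) :: 'a fps)"
      using inverse_mult_eq_1[of "1 - fps_X :: 'a fps"] by (simp flip: mult.assoc)
    thus ?thesis unfolding eq by (rule sym)
  qed
  thus ?case by (simp add: Suc.IH [symmetric] mult_ac)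
qed

lemma fps_mobius_power_nth:
  assumes "j \<ge> 1"
  shows "fps_nth ((fps_X * inverse (1 - fps_X)) ^ j) n =
           (if n = 0 then 0 else of_nat ((n - 1) choose (j - 1)) :: 'a :: field_char_0)"
proof -
  have "(fps_X * inverse (1 - fps_X) :: 'a fps) ^ j = fps_X * (inverse (1 - fps_X) * (fps_X * inverse (1 - fps_X)) ^ (j - 1))"
    using assms by (cases j) (simp_all add: mult_ac)
  thus ?thesis unfolding fps_binomial_column by simp
qed

text \<open>With \<open>x = 1/n\<close> the function is the increment, from \<open>n - 1\<close> to
  \<open>n\<close>, of the error in the expansion of the harmonic numbers. In its coefficient of
  \<open>x^n\<close> the two copies of \<open>hcoeff n\<close> cancel, and the remaining sum cancels
  \<open>-1/n\<close> from the logarithm by \<open>hcoeff_recurrence\<close> with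
  \<open>M = n - 1\<close>.\<close>

lemma harm_increment_bound:
  obtains C where "eventually (\<lambda>x. norm (x + ln (1 - x) - (\<Sum>j=1..N. hcoeff j * x ^ j) +
     (\<Sum>j=1..N. hcoeff j * (x * inverse (1 - x)) ^ j)) \<le> C * norm x ^ Suc N) (at 0)"
proof -
  \<comment> \<open>Division by zero makes the constant coefficient 0, in accordance with
    \<open>ln 1 = 0\<close>.\<close>
  define L where "L = Abs_fps (\<lambda>n. - 1 / of_nat n :: complex)"
  have "eventually (\<lambda>u. u \<in> ball 0 1) (nhds (0::complex))"
    by (intro eventually_nhds_in_open) auto
  hence "(\<lambda>x. ln (1 - x)) has_fps_expansion L"
  proof (intro has_fps_expansionI, eventually_elim)
    case (elim u)
    thus ?case using Ln_series'[of "-u"] by (simp add: L_def)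
  qed
  hence exp: "(\<lambda>x. x + ln (1 - x) - (\<Sum>j=1..N. hcoeff j * x ^ j) + (\<Sum>j=1..N. hcoeff j * (x * inverse (1 - x)) ^ j))
     has_fps_expansion (fps_X + L - (\<Sum>j=1..N. fps_const (hcoeff j) * fps_X ^ j)
          + (\<Sum>j=1..N. fps_const (hcoeff j) * (fps_X * inverse (1 - fps_X)) ^ j))"
    by (intro fps_expansion_intros) auto
  show thesis
  proof (rule has_fps_expansion_bound[OF exp _ that])
    fix n assume n: "n < Suc N"
    show "(fps_X + L - (\<Sum>j=1..N. fps_const (hcoeff j) * fps_X ^ j)
          + (\<Sum>j=1..N. fps_const (hcoeff j) * (fps_X * inverse (1 - fps_X)) ^ j)) $ n = 0"
    proof (cases "n = 0")
      case True
      thus ?thesis by (auto simp: L_def fps_sum_nth fps_mobius_power_nth fps_X_power_nth intro!: sum.neutral)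
    next
      case False
      have s1: "(\<Sum>j=1..N. hcoeff j * (fps_X ^ j $ n)) = hcoeff n"
      proof -
        have "(\<Sum>j=1..N. hcoeff j * (fps_X ^ j $ n)) = (\<Sum>j=1..N. if j = n then hcoeff j else 0)"
          by (intro sum.cong) (auto simp: fps_X_power_nth)
        thus ?thesis using n False by simp
      qed
      have s2: "(\<Sum>j=1..N. hcoeff j * ((fps_X * inverse (1 - fps_X)) ^ j $ n)) =
                  hcoeff n + (\<Sum>j=1..n-1. of_nat ((n - 1) choose (j - 1)) * hcoeff j)"
      proof -
        have "(\<Sum>j=1..N. hcoeff j * ((fps_X * inverse (1 - fps_X)) ^ j $ n)) =
                (\<Sum>j=1..n. of_nat ((n - 1) choose (j - 1)) * hcoeff j)"
          using n False by (intro sum.mono_neutral_cong_right) (auto simp: fps_mobius_power_nth binomial_eq_0)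
        also have "{1..n} = insert n {1..n-1}" using False by auto
        finally show ?thesis using False by simp
      qed
      have "(\<Sum>j=1..n-1. of_nat ((n - 1) choose (j - 1)) * hcoeff j) = (if n = 1 then 0 else 1 / of_nat n)"
        using hcoeff_recurrence[of "n - 1"] False by auto
      thus ?thesis using False
        unfolding fps_add_nth fps_sub_nth fps_sum_nth fps_mult_left_const_nth s1 s2
        by (simp add: L_def fps_X_nth)
    qed
  qed
qed

text \<open>The error tends to 0 by the definition of the Euler-Mascheroni constant and has
  increments of order \<open>n^(-N-1)\<close>, so telescoping applies. The exponent is not sharp,
  but \<open>N\<close> is free.\<close>

lemma harm_asymptotic:
  "growth (\<lambda>n. harm (Suc n) - ln (of_nat (Suc n)) - euler_mascheroni -
      (\<Sum>j=1..N. hcoeff j / of_nat (Suc n) ^ j)) (1 - real N)"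
proof -
  define d where "d = (\<lambda>n. harm (Suc n) - ln (of_nat (Suc n)) - euler_mascheroni -
      (\<Sum>j=1..N. hcoeff j / of_nat (Suc n) ^ j))"
  define \<phi> where "\<phi> = (\<lambda>x. x + ln (1 - x) - (\<Sum>j=1..N. hcoeff j * x ^ j) +
     (\<Sum>j=1..N. hcoeff j * (x * inverse (1 - x)) ^ j))"
  \<comment> \<open>The reciprocal of the larger integer in the step from \<open>d n\<close> to
    \<open>d (Suc n)\<close>.\<close>
  define x where "x = (\<lambda>n. 1 / of_nat (Suc (Suc n)) :: complex)"
  show ?thesis
  \<comment> \<open>For \<open>N = 0\<close> the exponent is 1, outside the range of
    \<open>growth_telescope\<close>, and a direct bound suffices.\<close>
  proof (cases "N = 0")
    case True
    have "growth (\<lambda>n. harm (Suc n) - ln (of_nat (Suc n)) - euler_mascheroni) 1"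
      by (intro growth_diff growth_harm growth_ln growth_mono[OF growth_const]) auto
    thus ?thesis by (simp add: True)
  next
    case False
    have "growth d (1 - real N)"
    proof (rule growth_telescope)
      have "(\<lambda>n. of_real (harm n - ln (real n)) - euler_mascheroni) \<longlonglongrightarrow> (0 :: complex)"
        using euler_mascheroni_LIMSEQ_of_real[where ?'a = complex] by (simp add: LIM_zero)
      from LIMSEQ_Suc[OF this]
      have 1: "(\<lambda>n. harm (Suc n) - ln (of_nat (Suc n)) - euler_mascheroni) \<longlonglongrightarrow> (0 :: complex)"
        by (simp add: of_real_harm Ln_of_nat del: of_nat_Suc)
      have 2: "(\<lambda>n. hcoeff j * (1 / of_nat (Suc n)) ^ j) \<longlonglongrightarrow> hcoeff j * 0 ^ j" for j
        by (intro tendsto_intros LIMSEQ_Suc[OF lim_1_over_n])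
      have "(\<lambda>n. harm (Suc n) - ln (of_nat (Suc n)) - euler_mascheroni - (\<Sum>j=1..N. hcoeff j * (1 / of_nat (Suc n)) ^ j)) \<longlonglongrightarrow>
               (0 - (\<Sum>j=1..N. hcoeff j * 0 ^ j) :: complex)"
        by (intro tendsto_diff[OF 1] tendsto_sum 2)
      also have "(0 - (\<Sum>j=1..N. hcoeff j * 0 ^ j) :: complex) = 0"
        by (auto intro!: sum.neutral)
      finally show "d \<longlonglongrightarrow> 0" by (simp add: d_def power_one_over field_simps del: of_nat_Suc)
      show "growth (\<lambda>n. d (Suc n) - d n) (1 - real N - 2)"
      proof -
        have incr: "d (Suc n) - d n = \<phi> (x n)" for n
        proof -
          have "1 - 1 / real (Suc (Suc n)) = real (Suc n) / real (Suc (Suc n))"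
            by (simp add: field_simps)
          hence "ln (1 - 1 / real (Suc (Suc n))) = ln (real (Suc n)) - ln (real (Suc (Suc n)))"
            by (simp only: ln_divide_pos of_nat_0_less_iff zero_less_Suc)
          moreover have "ln (1 - x n) = of_real (ln (1 - 1 / real (Suc (Suc n))))"
          proof -
            have "1 - x n = of_real (1 - 1 / real (Suc (Suc n)))"
              by (simp add: x_def)
            thus ?thesis by (simp only: Ln_of_real) (subst Ln_of_real, auto)
          qed
          ultimately have l: "ln (1 - x n) = ln (of_nat (Suc n)) - ln (of_nat (Suc (Suc n)))"
            by (simp add: Ln_of_nat del: of_nat_Suc)
          have m: "x n * inverse (1 - x n) = 1 / of_nat (Suc n)"
            unfolding x_def by (simp add: divide_simps del: of_nat_Suc) simp
          have h: "harm (Suc (Suc n)) = harm (Suc n) + x n"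
            by (simp add: x_def harm_Suc inverse_eq_divide)
          show ?thesis
            unfolding d_def \<phi>_def l m h by (simp add: x_def power_one_over algebra_simps del: of_nat_Suc)
        qed
        obtain C where C: "eventually (\<lambda>x. norm (\<phi> x) \<le> C * norm x ^ Suc N) (at 0)"
          unfolding \<phi>_def using harm_increment_bound by blast
        have "filterlim x (at 0) sequentially"
        proof (rule filterlim_atI)
          show "x \<longlonglongrightarrow> 0" unfolding x_def by (intro LIMSEQ_Suc lim_1_over_n)
        qed (auto simp: x_def simp del: of_nat_Suc)
        from eventually_compose_filterlim[OF C this]
        have ev: "eventually (\<lambda>n. norm (\<phi> (x n)) \<le> C * norm (x n) ^ Suc N) sequentially" .
        have "growth (\<lambda>n. \<phi> (x n)) (1 - real N - 2)"
        proof (rule growthI)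
          \<comment> \<open>The absolute value is taken because the constant \<open>C\<close> is not
            known to be nonnegative.\<close>
          show "eventually (\<lambda>n. norm (\<phi> (x n)) \<le> \<bar>C\<bar> * real (Suc n) powr (1 - real N - 2)) sequentially"
            using ev
          proof eventually_elim
            case (elim n)
            have "norm (x n) ^ Suc N = real (Suc (Suc n)) powr (- real (Suc N))"
              by (simp add: x_def norm_divide power_one_over powr_minus powr_realpow divide_simps del: of_nat_Suc power_Suc)
            also have "\<dots> \<le> real (Suc n) powr (- real (Suc N))"
              by (intro powr_mono2') auto
            also have "- real (Suc N) = 1 - real N - 2" by simp
            finally have le: "norm (x n) ^ Suc N \<le> real (Suc n) powr (1 - real N - 2)" .
            have "norm (\<phi> (x n)) \<le> \<bar>C\<bar> * norm (x n) ^ Suc N"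
              using elim by (rule order.trans) (intro mult_right_mono, auto)
            also have "\<dots> \<le> \<bar>C\<bar> * real (Suc n) powr (1 - real N - 2)"
              by (intro mult_left_mono le) auto
            finally show ?case .
          qed
        qed
        thus ?thesis by (simp add: incr)
      qed
    qed (use False in auto)
    thus ?thesis by (simp add: d_def)
  qed
qed

section \<open>Powers of harmonic numbers\<close>

text \<open>The series \<open>\<gamma> + f(x)\<close> truncated after \<open>x^N\<close>, to be
  evaluated at the reciprocal of an integer.\<close>

definition asymp_poly :: "nat \<Rightarrow> complex poly" where
  "asymp_poly N = [:euler_mascheroni:] + (\<Sum>j=1..N. monom (hcoeff j) j)"

lemma poly_asymp_poly:
  "poly (asymp_poly N) x = euler_mascheroni + (\<Sum>j=1..N. hcoeff j * x ^ j)"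
  by (simp add: asymp_poly_def poly_sum poly_monom)

lemma fps_power_cong:
  assumes "\<And>j. j \<le> N \<Longrightarrow> fps_nth F j = fps_nth G j" "n \<le> N"
  shows "fps_nth (F ^ i) n = fps_nth (G ^ i) n"
  using assms(2)
proof (induction i arbitrary: n)
  case (Suc i)
  show ?case
    unfolding power_Suc fps_mult_nth
    by (intro sum.cong refl arg_cong2[of _ _ _ _ "(*)"] assms(1) Suc.IH) (use Suc.prems in auto)
qed auto

lemma coeff_asymp_poly_power:
  assumes "n \<le> N"
  shows "coeff (asymp_poly N ^ i) n = fps_nth ((fps_const euler_mascheroni + f_series) ^ i) n"
proof -
  have "coeff (asymp_poly N ^ i) n = fps_nth (fps_of_poly (asymp_poly N) ^ i) n"
    by (simp flip: fps_of_poly_power)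
  also have "\<dots> = fps_nth ((fps_const euler_mascheroni + f_series) ^ i) n"
  proof (rule fps_power_cong[OF _ assms])
    fix j assume j: "j \<le> N"
    show "fps_nth (fps_of_poly (asymp_poly N)) j = fps_nth (fps_const euler_mascheroni + f_series) j"
      using j by (cases j) (auto simp: asymp_poly_def coeff_sum f_series_def hcoeff_def)
  qed
  finally show ?thesis .
qed

lemma poly_eq_sum_atMost:
  fixes p :: "'a :: comm_semiring_1 poly"
  assumes "degree p \<le> D"
  shows "poly p x = (\<Sum>i\<le>D. coeff p i * x ^ i)"
  unfolding poly_altdef
  by (rule sum.mono_neutral_left) (use assms in \<open>auto simp: coeff_eq_0\<close>)

text \<open>The factor \<open>x - y\<close> splits off from \<open>x^m - y^m\<close>, and the
  cofactor grows at most like \<open>n^m\<close>. The loss of \<open>m\<close> powers is made up for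
  by a longer expansion.\<close>

lemma growth_power_diff:
  assumes "growth (\<lambda>n. x n - y n) a" "growth x 1" "growth y 1"
  shows "growth (\<lambda>n. x n ^ m - y n ^ m) (a + real m)"
proof (cases m)
  case 0
  thus ?thesis by (auto intro: growthI[of _ 0])
next
  case (Suc k)
  have "growth (\<lambda>n. x n ^ p * y n ^ (k - p)) (real m)" if "p < Suc k" for p
    by (rule growth_mono[OF growth_mult[OF growth_power[OF assms(2)] growth_power[OF assms(3)]]])
       (use that Suc in auto)
  hence "growth (\<lambda>n. \<Sum>p<Suc k. x n ^ p * y n ^ (k - p)) (real m)"
    by (intro growth_sum) auto
  from growth_mult[OF assms(1) this] show ?thesis
    unfolding Suc diff_power_eq_sum .
qed

text \<open>Truncation at \<open>N + m + 1\<close> leaves the error exponent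
  \<open>1 - (N + m + 1) + m = - N\<close>. The double sum is the binomial expansion of the power of
  logarithm plus polynomial, with one degree bound \<open>D\<close> for all
  \<open>k\<close>.\<close>

lemma harm_power_asymptotic:
  fixes m N D :: nat
  assumes D: "\<And>k. k \<le> m \<Longrightarrow> degree (asymp_poly (N + m + 1) ^ k) \<le> D"
  shows "growth (\<lambda>n. harm (Suc n) ^ m - (\<Sum>k\<le>m. \<Sum>j\<le>D. of_nat (m choose k) *
           coeff (asymp_poly (N + m + 1) ^ (m - k)) j * (ln (of_nat (Suc n)) ^ k / of_nat (Suc n) ^ j))) (- real N)"
proof -
  define P where "P = asymp_poly (N + m + 1)"
  define y where "y = (\<lambda>n. ln (of_nat (Suc n)) + poly P (1 / of_nat (Suc n)))"
  have r: "growth (\<lambda>n. harm (Suc n) - y n) (1 - real (N + m + 1))"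
    using harm_asymptotic[of "N + m + 1"]
    by (simp add: y_def P_def poly_asymp_poly power_one_over algebra_simps del: of_nat_Suc)
  have h: "growth (\<lambda>n. harm (Suc n)) 1" by (rule growth_harm) auto
  have "growth (\<lambda>n. harm (Suc n) - y n) 1"
    by (rule growth_mono[OF r]) auto
  from growth_diff[OF h this] have y: "growth y 1" by simp
  have "growth (\<lambda>n. harm (Suc n) ^ m - y n ^ m) (1 - real (N + m + 1) + real m)"
    by (intro growth_power_diff r h y)
  moreover have "y n ^ m = (\<Sum>k\<le>m. \<Sum>j\<le>D. of_nat (m choose k) *
           coeff (P ^ (m - k)) j * (ln (of_nat (Suc n)) ^ k / of_nat (Suc n) ^ j))" for n
  proof -
    have "y n ^ m = (\<Sum>k\<le>m. of_nat (m choose k) * ln (of_nat (Suc n)) ^ k * poly P (1 / of_nat (Suc n)) ^ (m - k))"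
      unfolding y_def by (rule binomial_ring)
    also have "\<dots> = (\<Sum>k\<le>m. \<Sum>j\<le>D. of_nat (m choose k) *
           coeff (P ^ (m - k)) j * (ln (of_nat (Suc n)) ^ k / of_nat (Suc n) ^ j))"
    proof (intro sum.cong refl)
      fix k assume "k \<in> {..m}"
      have "poly P (1 / of_nat (Suc n)) ^ (m - k) = (\<Sum>j\<le>D. coeff (P ^ (m - k)) j * (1 / of_nat (Suc n)) ^ j)"
        unfolding poly_power [symmetric] by (rule poly_eq_sum_atMost) (use D in \<open>auto simp: P_def\<close>)
      thus "of_nat (m choose k) * ln (of_nat (Suc n)) ^ k * poly P (1 / of_nat (Suc n)) ^ (m - k) =
            (\<Sum>j\<le>D. of_nat (m choose k) * coeff (P ^ (m - k)) j * (ln (of_nat (Suc n)) ^ k / of_nat (Suc n) ^ j))"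
        by (simp only: sum_distrib_left power_one_over) (simp add: mult_ac del: of_nat_Suc)
    qed
    finally show ?thesis .
  qed
  moreover have "1 - real (N + m + 1) + real m = - real N" by simp
  ultimately show ?thesis by (simp only: P_def)
qed

lemma growth_harm_power: "\<epsilon> > 0 \<Longrightarrow> growth (\<lambda>n. harm (Suc n) ^ m) \<epsilon>"
  by (rule growth_mono[OF growth_power[OF growth_harm[of "\<epsilon> / real (Suc m)"]]]) (auto simp: field_simps)

section \<open>Continuation and Laurent coefficients of the harmonic zeta function\<close>

lemma dseries_term_shift:
  "x / of_nat (Suc n) ^ j / of_nat (Suc n) powr s = x / of_nat (Suc n) powr (s + of_nat j :: complex)"
  by (simp add: powr_add powr_nat' mult_ac del: of_nat_Suc)

text \<open>Dividing by \<open>(n+1)^j\<close> shifts \<open>s\<close> by \<open>j\<close>, so every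
  term of the expansion contributes one pole term at \<open>1 - j\<close> and an entire function.
  Coefficients with \<open>j > N\<close> may be distorted by the truncation, but their poles lie
  outside the half-plane.\<close>

lemma harm_dseries_halfplane:
  fixes m N :: nat
  obtains A b D where "A holomorphic_on {s. Re s > 1 - real N}"
    "\<And>s. Re s > 1 \<Longrightarrow> dseries (\<lambda>n. harm (Suc n) ^ m) s =
        (\<Sum>k\<le>m. \<Sum>j\<le>D. b k j / (s + of_nat j - 1) ^ Suc k) + A s"
    "\<And>k j. j \<le> N \<Longrightarrow> b k j = of_nat (m choose k) * fact k *
        fps_nth ((fps_const euler_mascheroni + f_series) ^ (m - k)) j"
    "N \<le> D"
proof -
  \<comment> \<open>Large enough to bound all the degrees and also \<open>N\<close>.\<close>
  define D where "D = N + (\<Sum>k\<le>m. degree (asymp_poly (N + m + 1) ^ k))"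
  have D: "degree (asymp_poly (N + m + 1) ^ k) \<le> D" if "k \<le> m" for k
    unfolding D_def using member_le_sum[of k "{..m}" "\<lambda>k. degree (asymp_poly (N + m + 1) ^ k)"] that by simp
  obtain E where E: "\<And>k. E k holomorphic_on UNIV"
    "\<And>k s. Re s > 1 \<Longrightarrow> dseries (\<lambda>n. ln (of_nat (Suc n)) ^ k) s = fact k / (s - 1) ^ Suc k + E k s"
    using dseries_ln_power_entire by blast
  define c where "c = (\<lambda>k j. of_nat (m choose k) * coeff (asymp_poly (N + m + 1) ^ (m - k)) j)"
  define e where "e = (\<lambda>n. harm (Suc n) ^ m - (\<Sum>k\<le>m. \<Sum>j\<le>D. c k j * (ln (of_nat (Suc n)) ^ k / of_nat (Suc n) ^ j)))"
  have e: "growth e (- real N)"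
    unfolding e_def c_def by (rule harm_power_asymptotic[OF D])
  define A where "A = (\<lambda>s. (\<Sum>k\<le>m. \<Sum>j\<le>D. c k j * E k (s + of_nat j)) + dseries e s)"
  show thesis
  proof (rule that)
    show "A holomorphic_on {s. Re s > 1 - real N}"
      unfolding A_def using dseries_holomorphic[OF e]
      by (intro holomorphic_intros holomorphic_on_compose_gen[OF _ E(1), unfolded o_def]) auto
    show "N \<le> D" by (simp add: D_def)
    show "c k j * fact k = of_nat (m choose k) * fact k *
        fps_nth ((fps_const euler_mascheroni + f_series) ^ (m - k)) j" if "j \<le> N" for k j
      using that by (simp add: c_def coeff_asymp_poly_power)
    fix s :: complex assume s: "Re s > 1"
    have L: "(\<lambda>n. ln (of_nat (Suc n)) ^ k / of_nat (Suc n) ^ j / of_nat (Suc n) powr s) sums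
               (fact k / (s + of_nat j - 1) ^ Suc k + E k (s + of_nat j))" for k j
    proof -
      have s': "Re (s + of_nat j) > 1" using s by simp
      have "summable (\<lambda>n. ln (of_nat (Suc n)) ^ k / of_nat (Suc n) powr (s + of_nat j))"
        by (rule dseries_summable_eps[OF growth_ln_power s'])
      thus ?thesis
        unfolding dseries_term_shift E(2)[OF s', symmetric] dseries_def by (rule summable_sums)
    qed
    have e_sums: "(\<lambda>n. e n / of_nat (Suc n) powr s) sums dseries e s"
      unfolding dseries_def by (intro summable_sums dseries_deriv(1)[OF e]) (use s in auto)
    have "(\<lambda>n. (\<Sum>k\<le>m. \<Sum>j\<le>D. c k j * (ln (of_nat (Suc n)) ^ k / of_nat (Suc n) ^ j / of_nat (Suc n) powr s)) + e n / of_nat (Suc n) powr s) sums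
          ((\<Sum>k\<le>m. \<Sum>j\<le>D. c k j * (fact k / (s + of_nat j - 1) ^ Suc k + E k (s + of_nat j))) + dseries e s)"
      by (intro sums_add sums_sum sums_mult L e_sums)
    also have "(\<lambda>n. (\<Sum>k\<le>m. \<Sum>j\<le>D. c k j * (ln (of_nat (Suc n)) ^ k / of_nat (Suc n) ^ j / of_nat (Suc n) powr s)) + e n / of_nat (Suc n) powr s)
       = (\<lambda>n. harm (Suc n) ^ m / of_nat (Suc n) powr s)"
      by (simp add: e_def diff_divide_distrib sum_divide_distrib del: of_nat_Suc)
    finally show "dseries (\<lambda>n. harm (Suc n) ^ m) s =
        (\<Sum>k\<le>m. \<Sum>j\<le>D. c k j * fact k / (s + of_nat j - 1) ^ Suc k) + A s"
      by (simp add: dseries_def sums_iff A_def distrib_left sum.distrib)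
  qed
qed

lemma harmonic_zeta_continuation:
  "is_meromorphic_continuation (dseries (\<lambda>n. harm (Suc n) ^ m)) (harmonic_zeta m)"
proof -
  have "is_meromorphic_continuation (dseries (\<lambda>n. harm (Suc n) ^ m))
          (meromorphic_continuation (dseries (\<lambda>n. harm (Suc n) ^ m)))"
  proof (rule meromorphic_continuation_halfplanes)
    show "dseries (\<lambda>n. harm (Suc n) ^ m) holomorphic_on {s. Re s > 1}"
      by (intro dseries_holomorphic_eps growth_harm_power)
    fix N :: nat
    obtain A b D where A: "A holomorphic_on {s. Re s > 1 - real (Suc N)}"
      "\<And>s. Re s > 1 \<Longrightarrow> dseries (\<lambda>n. harm (Suc n) ^ m) s =
          (\<Sum>k\<le>m. \<Sum>j\<le>D. b k j / (s + of_nat j - 1) ^ Suc k) + A s"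
      by (rule harm_dseries_halfplane[where m = m and N = "Suc N"]) (rule that)
    have "A meromorphic_on {s. Re s > - real N}"
      using A(1) by (intro analytic_on_imp_meromorphic_on) (simp add: analytic_on_open open_halfspace_Re_gt)
    hence "(\<lambda>s. (\<Sum>k\<le>m. \<Sum>j\<le>D. b k j / (s + of_nat j - 1) ^ Suc k) + A s) meromorphic_on {s. Re s > - real N}"
      by (intro meromorphic_intros)
    thus "\<exists>F. F meromorphic_on {s. Re s > - real N} \<and> (\<forall>s. Re s > 1 \<longrightarrow> F s = dseries (\<lambda>n. harm (Suc n) ^ m) s)"
      using A(2) by (intro exI[of _ "\<lambda>s. (\<Sum>k\<le>m. \<Sum>j\<le>D. b k j / (s + of_nat j - 1) ^ Suc k) + A s"]) auto
  qed
  thus ?thesis by (simp add: harmonic_zeta_def dseries_def [abs_def])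
qed

text \<open>The half-plane with \<open>N = n + 1\<close> contains \<open>1 - n\<close>, and there
  only the summands with \<open>j = n\<close> are singular.\<close>

lemma harmonic_zeta_coeff_eq:
  "harmonic_zeta_coeff m (1 - of_nat n) (Suc k) =
     (if k \<le> m then of_nat (m choose k) * fact k *
        fps_nth ((fps_const euler_mascheroni + f_series) ^ (m - k)) n else 0)"
proof -
  obtain A b D where A: "A holomorphic_on {s. Re s > 1 - real (Suc n)}"
    "\<And>s. Re s > 1 \<Longrightarrow> dseries (\<lambda>n. harm (Suc n) ^ m) s =
        (\<Sum>k\<le>m. \<Sum>j\<le>D. b k j / (s + of_nat j - 1) ^ Suc k) + A s"
    and b: "\<And>k j. j \<le> Suc n \<Longrightarrow> b k j = of_nat (m choose k) * fact k *
        fps_nth ((fps_const euler_mascheroni + f_series) ^ (m - k)) j"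
    and D: "Suc n \<le> D"
    by (rule harm_dseries_halfplane[where m = m and N = "Suc n"]) (rule that)
  define z where "z = (1 - of_nat n :: complex)"
  define F where "F = (\<lambda>s. (\<Sum>k\<le>m. \<Sum>j\<le>D. b k j / (s + of_nat j - 1) ^ Suc k) + A s)"
  have A': "A analytic_on {s. Re s > - real n}"
    using A(1) by (simp add: analytic_on_open open_halfspace_Re_gt)
  have "eventually (\<lambda>s. harmonic_zeta m s = F s) (at z)"
  proof (rule meromorphic_halfplane_identity[where a = "- real n" and b = 1])
    show "harmonic_zeta m meromorphic_on {s. - real n < Re s}"
      using harmonic_zeta_continuation[of m]
      by (auto simp: is_meromorphic_continuation_def nicely_meromorphic_on_def intro: meromorphic_on_subset)
    show "F meromorphic_on {s. - real n < Re s}"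
      unfolding F_def by (intro meromorphic_intros analytic_on_imp_meromorphic_on A')
    show "harmonic_zeta m s = F s" if "Re s > 1" for s
      using harmonic_zeta_continuation[of m] that
      by (simp add: is_meromorphic_continuation_def F_def A(2) del: of_nat_Suc)
  qed (auto simp: z_def)
  hence "eventually (\<lambda>s. harmonic_zeta m s = F s) (filtermap (\<lambda>w. w + z) (at 0))"
    by (subst (asm) at_to_0') simp
  hence ev: "eventually (\<lambda>w. harmonic_zeta m (z + w) = F (z + w)) (at 0)"
    unfolding eventually_filtermap by (simp only: add.commute[of z])
  \<comment> \<open>Everything regular at the centre, in the local variable
    \<open>w = s - z\<close>.\<close>
  define G where "G = (\<lambda>w. (\<Sum>k\<le>m. \<Sum>j\<in>{..D}-{n}. b k j / (z + w + of_nat j - 1) ^ Suc k) + A (z + w))"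
  have F_eq: "F (z + w) = (\<Sum>k\<le>m. b k n * w powi (- int (Suc k))) + G w" for w
  proof -
    have "(\<Sum>j\<le>D. b k j / (z + w + of_nat j - 1) ^ Suc k) =
            b k n * w powi (- int (Suc k)) + (\<Sum>j\<in>{..D}-{n}. b k j / (z + w + of_nat j - 1) ^ Suc k)" for k
      using D by (subst sum.remove[of _ n])
                 (auto simp: z_def power_int_minus field_simps simp del: power_Suc of_nat_Suc)
    thus ?thesis unfolding F_def G_def by (simp add: sum.distrib del: power_Suc of_nat_Suc)
  qed
  have "G analytic_on {0}"
  proof -
    have "(\<lambda>w. A (z + w)) analytic_on {0}"
      by (rule analytic_on_compose_gen[OF _ A', unfolded o_def]) (auto intro!: analytic_intros simp: z_def)
    moreover have "z + 0 + of_nat j - 1 \<noteq> 0" if "j \<noteq> n" for j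
      using that by (simp add: z_def)
    ultimately show ?thesis
      unfolding G_def by (intro analytic_intros) auto
  qed
  then obtain g where g: "G has_fps_expansion g"
    using analytic_at_imp_has_fps_expansion_0 by blast
  have "(\<lambda>w. (\<Sum>k\<le>m. b k n * w powi (- int (Suc k))) + G w) has_laurent_expansion
          (\<Sum>k\<le>m. fls_const (b k n) * fls_X_intpow (- int (Suc k))) + fps_to_fls g"
    by (intro laurent_expansion_intros has_laurent_expansion_fps g)
  also have "?this \<longleftrightarrow> (\<lambda>w. harmonic_zeta m (z + w)) has_laurent_expansion
          (\<Sum>k\<le>m. fls_const (b k n) * fls_X_intpow (- int (Suc k))) + fps_to_fls g"
    by (rule has_laurent_expansion_cong) (use ev in \<open>auto elim!: eventually_mono simp: F_eq\<close>)
  finally have "laurent_expansion (harmonic_zeta m) z =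
     (\<Sum>k\<le>m. fls_const (b k n) * fls_X_intpow (- int (Suc k))) + fps_to_fls g"
    by (rule laurent_expansion_eqI)
  hence "harmonic_zeta_coeff m z (Suc k) = (\<Sum>i\<le>m. b i n * (if i = k then 1 else 0))"
    by (simp add: harmonic_zeta_coeff_def fls_nth_sum)
  also have "\<dots> = (if k \<le> m then b k n else 0)"
    by (simp add: if_distrib cong: if_cong)
  finally show ?thesis by (simp add: z_def b)
qed

section \<open>Rearranging the coefficients\<close>

text \<open>As \<open>f_series\<close> has no constant term, its \<open>l\<close>-th power starts at
  \<open>x^l\<close> or later. In the Cauchy product the terms with \<open>j = 0\<close> or
  \<open>n - j < l\<close> vanish, which is the range cut off in the recursion.\<close>

lemma a_coeff_eq: "a_coeff n l = fps_nth (f_series ^ l) n"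
proof (induction l arbitrary: n)
  case (Suc l)
  have low: "fps_nth (f_series ^ l) i = 0" if i: "i < l" for i
  proof (cases "f_series = 0")
    case False
    hence "1 \<le> subdegree f_series"
      by (rule subdegree_geI) (simp add: f_series_def)
    hence "l * 1 \<le> l * subdegree f_series"
      by (intro mult_left_mono) auto
    with i have "i < l * subdegree f_series"
      by linarith
    thus ?thesis
      by (rule fps_pow_nth_below_subdegree)
  qed (use i in \<open>simp add: power_0_left\<close>)
  have "fps_nth (f_series ^ Suc l) n = (\<Sum>j=0..n. f_series $ j * (f_series ^ l) $ (n - j))"
    by (simp add: fps_mult_nth)
  also have "\<dots> = (\<Sum>j=1..n-l. f_series $ j * (f_series ^ l) $ (n - j))"
  proof (rule sum.mono_neutral_right)
    show "\<forall>j\<in>{0..n} - {1..n-l}. f_series $ j * (f_series ^ l) $ (n - j) = 0"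
    proof
      fix j assume j: "j \<in> {0..n} - {1..n-l}"
      show "f_series $ j * (f_series ^ l) $ (n - j) = 0"
      proof (cases "j = 0")
        case True
        thus ?thesis by (simp add: f_series_def)
      next
        case False
        with j have "n - j < l" by auto
        thus ?thesis by (simp add: low)
      qed
    qed
  qed auto
  also have "\<dots> = a_coeff n (Suc l)"
    unfolding a_coeff.simps by (intro sum.cong) (auto simp: Suc.IH f_series_def)
  finally show ?case by simp
qed auto

lemma a_coeff_rational: "a_coeff n l \<in> \<rat>"
proof (induction l arbitrary: n)
  case (Suc l)
  have "(-1) ^ j * riemann_zeta (1 - of_nat j) \<in> \<rat>" if "j \<ge> 1" for j
    using hcoeff_rational[OF that] by (simp add: hcoeff_def)
  thus ?case unfolding a_coeff.simps by (intro Rats_sum Rats_mult[OF _ Suc.IH]) auto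
qed auto

text \<open>In this form the vanishing for \<open>k > m\<close> is that of the binomial
  coefficient.\<close>

lemma prod_falling_eq:
  "(\<Prod>i<k. of_nat m - of_nat i :: complex) = of_nat (m choose k) * fact k"
  by (simp add: binomial_gbinomial gbinomial_prod_rev atLeast0LessThan)

lemma harmonic_zeta_coeff_prod:
  "harmonic_zeta_coeff m (1 - of_nat n) (Suc k) =
     (\<Prod>i<k. of_nat m - of_nat i) * fps_nth ((fps_const euler_mascheroni + f_series) ^ (m - k)) n"
  unfolding harmonic_zeta_coeff_eq prod_falling_eq by auto

text \<open>The binomial theorem for \<open>(f + \<gamma>)^(m-k)\<close>, with
  \<open>l = i + k\<close> and the identity \<open>(m choose (i+k)) ((i+k) choose k) = (m choose k)
  ((m-k) choose i)\<close>.\<close>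

lemma harmonic_zeta_coeff_sum:
  "harmonic_zeta_coeff m (1 - of_nat n) (Suc k) =
     (\<Sum>l\<le>m. of_nat (m choose l) * euler_mascheroni ^ (m - l) * a_coeff_k n l (Suc k))"
proof (cases "k \<le> m")
  case False
  have "a_coeff_k n l (Suc k) = 0" if "l \<le> m" for l
    using that False by (auto simp: a_coeff_k_def prod_falling_eq)
  thus ?thesis using False by (simp add: harmonic_zeta_coeff_eq)
next
  case True
  have "(\<Sum>l\<le>m. of_nat (m choose l) * euler_mascheroni ^ (m - l) * a_coeff_k n l (Suc k)) =
        (\<Sum>l=k..m. of_nat (m choose l) * euler_mascheroni ^ (m - l) * a_coeff_k n l (Suc k))"
    by (rule sum.mono_neutral_right) (auto simp: a_coeff_k_def prod_falling_eq)
  also have "\<dots> = (\<Sum>i\<le>m-k. of_nat (m choose (i + k)) * euler_mascheroni ^ (m - (i + k)) * a_coeff_k n (i + k) (Suc k))"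
    using True by (intro sum.reindex_bij_witness[of _ "\<lambda>i. i + k" "\<lambda>l. l - k"]) auto
  also have "\<dots> = (\<Sum>i\<le>m-k. of_nat (m choose k) * fact k * (of_nat ((m - k) choose i) * euler_mascheroni ^ (m - k - i) * fps_nth (f_series ^ i) n))"
  proof (intro sum.cong refl)
    fix i assume i: "i \<in> {..m-k}"
    have "(m choose (i + k)) * ((i + k) choose k) = (m choose k) * ((m - k) choose i)"
      using choose_mult[of k "i + k" m] i True by simp
    hence ch: "of_nat (m choose (i + k)) * of_nat ((i + k) choose k) = (of_nat (m choose k) * of_nat ((m - k) choose i) :: complex)"
      by (simp flip: of_nat_mult)
    have "of_nat (m choose (i + k)) * euler_mascheroni ^ (m - (i + k)) * a_coeff_k n (i + k) (Suc k) =
          (of_nat (m choose (i + k)) * of_nat ((i + k) choose k)) * fact k * euler_mascheroni ^ (m - (i + k)) * fps_nth (f_series ^ i) n"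
      by (simp add: a_coeff_k_def prod_falling_eq a_coeff_eq del: of_nat_add)
    thus "of_nat (m choose (i + k)) * euler_mascheroni ^ (m - (i + k)) * a_coeff_k n (i + k) (Suc k) =
       of_nat (m choose k) * fact k * (of_nat ((m - k) choose i) * euler_mascheroni ^ (m - k - i) * fps_nth (f_series ^ i) n)"
      unfolding ch by (simp add: add.commute mult_ac)
  qed
  also have "\<dots> = of_nat (m choose k) * fact k * (\<Sum>i\<le>m-k. of_nat ((m - k) choose i) * euler_mascheroni ^ (m - k - i) * fps_nth (f_series ^ i) n)"
    by (rule sum_distrib_left [symmetric])
  also have "(\<Sum>i\<le>m-k. of_nat ((m - k) choose i) * euler_mascheroni ^ (m - k - i) * fps_nth (f_series ^ i) n) =
      fps_nth ((f_series + fps_const euler_mascheroni) ^ (m - k)) n"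
  proof -
    have nth: "fps_nth (of_nat a * F * fps_const c ^ b) n = of_nat a * c ^ b * fps_nth F n"
      for a b c and F :: "complex fps"
    proof -
      have "of_nat a * F * fps_const c ^ b = fps_const (of_nat a * c ^ b) * F"
        unfolding fps_const_power fps_of_nat [symmetric] fps_const_mult [symmetric] by (simp only: mult_ac)
      thus ?thesis by simp
    qed
    show ?thesis
      unfolding binomial_ring fps_sum_nth nth ..
  qed
  finally show ?thesis using True by (simp add: harmonic_zeta_coeff_eq add.commute)
qed

theorem theorem14:
  fixes m :: nat
  assumes "m \<ge> 1"
  shows "(\<forall>n k. k \<ge> 1 \<longrightarrow>
            harmonic_zeta_coeff m (1 - of_nat n) k =
              (\<Sum>l\<le>m. of_nat (m choose l) * euler_mascheroni ^ (m - l) * a_coeff_k n l k)) \<and>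
         (\<forall>n l k. k \<ge> 1 \<longrightarrow> a_coeff_k n l k \<in> \<rat>) \<and>
         (\<forall>k. Abs_fps (\<lambda>n. harmonic_zeta_coeff m (1 - of_nat n) (k + 1)) =
                fps_const (\<Prod>i<k. of_nat m - of_nat i) *
                  (fps_const euler_mascheroni + f_series) ^ (m - k))"
proof (intro conjI allI impI)
  fix n k :: nat assume "k \<ge> 1"
  thus "harmonic_zeta_coeff m (1 - of_nat n) k =
          (\<Sum>l\<le>m. of_nat (m choose l) * euler_mascheroni ^ (m - l) * a_coeff_k n l k)"
    using harmonic_zeta_coeff_sum[of m n "k - 1"] by simp
next
  fix n l k :: nat
  show "a_coeff_k n l k \<in> \<rat>"
    unfolding a_coeff_k_def by (intro Rats_mult Rats_prod Rats_diff Rats_of_nat a_coeff_rational)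
next
  fix k
  show "Abs_fps (\<lambda>n. harmonic_zeta_coeff m (1 - of_nat n) (k + 1)) =
          fps_const (\<Prod>i<k. of_nat m - of_nat i) * (fps_const euler_mascheroni + f_series) ^ (m - k)"
    by (rule fps_ext) (simp add: harmonic_zeta_coeff_prod)
qed

end
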